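(* Let $q\neq1$ be a power of a prime. For any monic $f\in\mathbb{F}_q[X]$ of degree $\geq1$, let $X_f=\mathrm{Spec}(\mathbb{F}_q[X]/(f))$, let $Z(X_f)\in\mathbb{Q}(T)$ be its zeta function, and let $r(f)\geq0$ denote the order of the pole of $Z(X_f)$ at $T=1$. Then for any $u\in\mathbb{R}$, $$\lim_{d\to+\infty}\frac{\exp((1-e^{iu})\log d)}{q^d}\sum_{\deg(f)=d}e^{iu\,r(f)}=e^{iu}\tilde\Phi_1(u)\tilde\Phi_2(u),$$ where the sum runs over monic $f\in\mathbb{F}_q[X]$ of degree $d$, $\tilde\Phi_1(u)=1/\Gamma(e^{iu}+1)$ and $\tilde\Phi_2(u)=\prod_{\pi}(1-|\pi|^{-1})^{e^{iu}}(1+e^{iu}/(|\pi|-1))$, the product over all monic irreducible $\pi\in\mathbb{F}_q[X]$, with $|\pi|=q^{\deg(\pi)}$.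
   Context: The zeta function of $X_f$ is $Z(X_f)=\exp\bigl(\sum_{m\geq1}|X_f(\mathbb{F}_{q^m})|T^m/m\bigr)$; equivalently $Z(X_f)=\prod_{\pi\mid f}(1-T^{\deg(\pi)})^{-1}$, the product over the distinct monic irreducible polynomials $\pi$ dividing $f$. *)

theory Defs
  imports
    "HOL-Analysis.Analysis"
    "HOL-Computational_Algebra.Computational_Algebra"
    "HOL-Algebra.Algebraic_Closure_Type"
    "HOL-Algebra.QuotRing"
begin

text \<open>
  The field \<open>\<F>\<^sub>q\<close> is a type \<open>'a\<close> of sort \<open>{field, finite}\<close>, with \<open>q = CARD('a)\<close>.
  The name qualifiers below separate the type-class notions on \<open>'a poly\<close> from the
  homonymous ones on \<open>HOL-Algebra\<close> records.
\<close>

definition monic_polys :: "nat \<Rightarrow> 'a::{field,finite} poly set" where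
  "monic_polys d = {f. Polynomial.lead_coeff f = 1 \<and> Polynomial.degree f = d}"

definition monic_irreducibles :: "'a::{field,finite} poly set" where
  "monic_irreducibles = {p. Polynomial.lead_coeff p = 1 \<and> Factorial_Ring.irreducible p}"

definition poly_norm :: "'a::{field,finite} poly \<Rightarrow> real" where
  "poly_norm p = real CARD('a) ^ Polynomial.degree p"


subsection \<open>Points of \<open>X\<^sub>f = Spec(\<F>\<^sub>q[X]/(f))\<close>\<close>

definition poly_ideal :: "'a::{field,finite} poly \<Rightarrow> 'a poly set" where
  "poly_ideal f = Idl\<^bsub>ring_of_type_algebra\<^esub> {f}"

definition coord_ring :: "'a::{field,finite} poly \<Rightarrow> 'a poly set ring" where
  "coord_ring f = ring_of_type_algebra Quot (poly_ideal f)"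

definition coord_const :: "'a::{field,finite} poly \<Rightarrow> 'a \<Rightarrow> 'a poly set" where
  "coord_const f c = poly_ideal f +>\<^bsub>ring_of_type_algebra\<^esub> [:c:]"

text \<open>
  \<open>\<F>\<^bsub>q^m\<^esub>\<close> is the unique subfield with \<open>q^m\<close> elements of the algebraic closure of
  \<open>\<F>\<^sub>q\<close>, namely the fixed field of the \<open>m\<close>-th power of the \<open>q\<close>-Frobenius.
\<close>
definition ext_field :: "nat \<Rightarrow> 'a::{field,finite} alg_closure ring" where
  "ext_field m = ring_of_type_algebra\<lparr>carrier := {x. x ^ (CARD('a) ^ m) = x}\<rparr>"

text \<open>
  \<open>X\<^sub>f(\<F>\<^bsub>q^m\<^esub>)\<close>: the \<open>\<F>\<^sub>q\<close>-algebra homomorphisms from \<open>\<F>\<^sub>q[X]/(f)\<close> to \<open>\<F>\<^bsub>q^m\<^esub>\<close>.  Extensionality is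
  needed because \<open>ring_hom\<close> does not constrain functions outside the carrier.
\<close>
definition X_points :: "'a::{field,finite} poly \<Rightarrow> nat \<Rightarrow> ('a poly set \<Rightarrow> 'a alg_closure) set" where
  "X_points f m =
     {\<phi> \<in> Ring.ring_hom (coord_ring f) (ext_field m) \<inter> extensional (carrier (coord_ring f)).
        \<forall>c. \<phi> (coord_const f c) = to_ac c}"


subsection \<open>The zeta function and its pole at \<open>T = 1\<close>\<close>

definition zeta_series :: "'a::{field,finite} poly \<Rightarrow> rat fps" where
  "zeta_series f =
     fps_exp 1 oo Abs_fps (\<lambda>m. if m = 0 then 0 else of_nat (card (X_points f m)) / of_nat m)"

text \<open>The element of \<open>\<rat>(T)\<close> whose power series expansion at \<open>T = 0\<close> is \<open>zeta_series f\<close>.\<close>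
definition zeta :: "'a::{field,finite} poly \<Rightarrow> rat poly fract" where
  "zeta f = (THE Z. \<exists>P Q. Q \<noteq> 0 \<and> Z = Fraction_Field.Fract P Q \<and>
                      zeta_series f * fps_of_poly Q = fps_of_poly P)"

lemma zeta_eqI:
  assumes "Q \<noteq> 0" "zeta_series f * fps_of_poly Q = fps_of_poly P"
  shows   "zeta f = Fraction_Field.Fract P Q"
  unfolding zeta_def
proof (rule the_equality)
  fix Z
  assume "\<exists>P Q. Q \<noteq> 0 \<and> Z = Fraction_Field.Fract P Q \<and>
                  zeta_series f * fps_of_poly Q = fps_of_poly P"
  then obtain P' Q' where *: "Q' \<noteq> 0" "Z = Fraction_Field.Fract P' Q'"
      "zeta_series f * fps_of_poly Q' = fps_of_poly P'" by blast
  have "fps_of_poly (P' * Q) = fps_of_poly (P * Q')"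
    unfolding fps_of_poly_mult *(3)[symmetric] assms(2)[symmetric] by (simp add: mult_ac)
  hence "P' * Q = P * Q'" by simp
  thus "Z = Fraction_Field.Fract P Q"
    using * assms(1) by (simp add: eq_fract)
qed (use assms in blast)

text \<open>
  \<open>quot_of_fract\<close> gives numerator and denominator in lowest terms, so the pole order at \<open>a\<close>
  is the multiplicity of \<open>a\<close> as a root of the denominator (and \<open>0\<close> if there is no pole).
\<close>
definition pole_order :: "rat \<Rightarrow> rat poly fract \<Rightarrow> nat" where
  "pole_order a Z = Polynomial.order a (snd (quot_of_fract Z))"

definition r :: "'a::{field,finite} poly \<Rightarrow> nat" where
  "r f = pole_order 1 (zeta f)"


subsection \<open>The limiting functions\<close>

text \<open>
  At \<open>e\<^bsup>iu\<^esup> = -1\<close> the argument is a pole of \<open>Gamma\<close>; there \<open>Gamma 0 = 0\<close> and \<open>1 / 0 = 0\<close> give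
  the correct value \<open>0\<close> of the entire function \<open>1 / Gamma\<close>.
\<close>
definition Phi1 :: "real \<Rightarrow> complex" where
  "Phi1 u = 1 / Gamma (exp (\<i> * of_real u) + 1)"

text \<open>
  The product over all monic irreducibles is the unordered one, i.e. the limit of the
  finite partial products along the net of finite subsets (as for \<open>infsum\<close>).
\<close>
definition Phi2 :: "'a::{field,finite} itself \<Rightarrow> real \<Rightarrow> complex" where
  "Phi2 _ u =
     Lim (finite_subsets_at_top (monic_irreducibles :: 'a poly set))
       (\<lambda>S. \<Prod>p\<in>S. of_real (1 - 1 / poly_norm p) powr exp (\<i> * of_real u) *
                      (1 + exp (\<i> * of_real u) / of_real (poly_norm p - 1)))"

end

theory Submission
  imports
    Defs
    "HOL-Complex_Analysis.Complex_Analysis"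
    "HOL-Real_Asymp.Real_Asymp"
begin

text \<open>
  Counting the roots of \<open>f\<close> that are fixed by the \<open>m\<close>-th power of Frobenius shows
  \<open>Z(X\<^sub>f) = \<Prod>\<^bsub>\<pi> | f\<^esub> (1 - T\<^bsup>deg \<pi>\<^esup>)\<^sup>-\<^sup>1\<close>, so \<open>r(f)\<close> is the number of prime divisors of \<open>f\<close>.  With
  \<open>z = e\<^bsup>iu\<^esup>\<close>, the generating function of the sums \<open>\<Sum> z\<^bsup>r(f)\<^esup>\<close> over monic \<open>f\<close> of degree \<open>d\<close> has an Euler
  product, and dividing by the \<open>z\<close>-th power of the one for \<open>z = 1\<close>, which is \<open>1 / (1 - q T)\<close>, gives
  \<open>F(T) = (1 - q T)\<^bsup>-z\<^esup> H(T)\<close>.  The local factors of \<open>H\<close> are \<open>1 + O(T\<^bsup>2 deg \<pi>\<^esup>)\<close>, so \<open>H\<close> is holomorphic for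
  \<open>|T| < q\<^bsup>-1/2\<^esup>\<close>, beyond the singularity \<open>T = 1/q\<close>; convolving its coefficients with those of
  \<open>(1 - q T)\<^bsup>-z\<^esup>\<close> yields the limit \<open>H(1/q) / \<Gamma>(z)\<close>.  The factorization is only needed for real
  \<open>T \<in> (0, 1/q)\<close>, where powers of positive reals are multiplicative; analytic continuation does the rest.
\<close>

subsection \<open>Polynomials over a finite field\<close>

text \<open>No count of irreducible polynomials enters. The analytic part rests on unique
  factorization and on the number q^d of monic polynomials of degree d. That number gives the Euler
  product at z = 1, and the sum over all monic polynomials also majorises every sum over primes;
  this is where the radius q^(-1/2) comes from. Euler products are obtained in the order of
  increasing degree, whereas the limit is stated with an unordered product. The quadratic bound on
  the local factors makes the convergence unconditional, so that one function H serves both. The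
  coefficients need neither contours nor singularity analysis: H converges beyond 1/q, so its
  rescaled coefficients decay geometrically, and dominated convergence only has to absorb
  (d/(d-k))^(1-z). For |z| <= 1 the exponent has real part between 0 and 2, hence the weight
  (k+1)^2. Finally 1/Gamma(z) = z/Gamma(z+1) accounts for the separate factor e^(iu) in the limit,
  and H(1/q) is the second limiting function because t = 1/|\<pi>| gives t/(1-t) =
  1/(|\<pi>|-1).\<close>

lemma finite_mult_closed_power_card:
  fixes y :: "'b::Fields.field"
  assumes "finite K" "0 \<in> K" "\<And>x y. x \<in> K \<Longrightarrow> y \<in> K \<Longrightarrow> x * y \<in> K" "y \<in> K"
  shows "y ^ card K = y"
proof (cases "y = 0")
  case True
  then show ?thesis using assms by (auto simp: power_0_left)
next
  case False
  let ?K = "K - {0}"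
  have inj: "inj_on ((*) y) ?K" using False by (auto simp: inj_on_def)
  have "(*) y ` ?K \<subseteq> ?K" using assms False by auto
  hence "(*) y ` ?K = ?K"
    by (intro endo_inj_surj) (use assms inj in auto)
  \<comment> \<open>Multiplication by \<open>y\<close> permutes the nonzero elements of
    \<open>K\<close>, so their product is unchanged by a factor \<open>y\<close> on each of
    them.\<close>
  hence "\<Prod>?K = (\<Prod>x\<in>?K. y * x)" using prod.reindex[OF inj, of "\<lambda>x. x"] by simp
  also have "\<dots> = y ^ card ?K * \<Prod>?K" by (simp add: prod.distrib)
  finally have "y ^ card ?K = 1" using assms(1) by simp
  moreover have "card K = Suc (card ?K)" using card_Suc_Diff1[OF assms(1,2)] by simp
  ultimately show ?thesis by simp
qed

lemma power_card_field: "(c::'a::{field,finite}) ^ CARD('a) = c"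
  by (rule finite_mult_closed_power_card) auto

lemma card_field_ge_2: "CARD('a::{field,finite}) \<ge> 2"
proof -
  have "card {0, 1 :: 'a} \<le> CARD('a)" by (intro card_mono) auto
  thus ?thesis by simp
qed

text \<open>Coefficient lists are taken of fixed length \<open>d\<close>, because
  \<open>Poly\<close> forgets trailing zeros and is injective only for a given length. The condition
  on coefficients is preferred to a bound on the degree since it is also right for d = 0, where only
  the zero polynomial remains.\<close>

lemma card_poly_coeff_zero_from:
  "card {g :: 'a::{field,finite} poly. \<forall>i\<ge>d. Polynomial.coeff g i = 0} = CARD('a) ^ d"
proof -
  have "bij_betw Poly {xs :: 'a list. length xs = d} {g. \<forall>i\<ge>d. Polynomial.coeff g i = 0}"
    unfolding bij_betw_def
  proof
    show "inj_on Poly {xs :: 'a list. length xs = d}"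
    proof (rule inj_onI)
      fix xs ys :: "'a list"
      assume *: "xs \<in> {xs. length xs = d}" "ys \<in> {xs. length xs = d}" "Poly xs = Poly ys"
      show "xs = ys"
      proof (rule nth_equalityI)
        fix i assume "i < length xs"
        moreover have "nth_default 0 xs i = nth_default 0 ys i"
          using *(3) by (metis coeff_Poly_eq)
        ultimately show "xs ! i = ys ! i" using * by (simp add: nth_default_def)
      qed (use * in auto)
    qed
    show "Poly ` {xs :: 'a list. length xs = d} = {g. \<forall>i\<ge>d. Polynomial.coeff g i = 0}"
    proof (intro equalityI subsetI)
      fix g :: "'a poly" assume g: "g \<in> {g. \<forall>i\<ge>d. Polynomial.coeff g i = 0}"
      have "g = Poly (map (Polynomial.coeff g) [0..<d])"
        using g by (intro poly_eqI) (auto simp: coeff_Poly_eq nth_default_def)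
      thus "g \<in> Poly ` {xs. length xs = d}" by auto
    qed (auto simp: coeff_Poly_eq nth_default_def)
  qed
  hence "card {g :: 'a poly. \<forall>i\<ge>d. Polynomial.coeff g i = 0} = card {xs :: 'a list. length xs = d}"
    by (rule bij_betw_same_card[symmetric])
  also have "\<dots> = CARD('a) ^ d"
    using card_lists_length_eq[of "UNIV :: 'a set" d] by simp
  finally show ?thesis .
qed

lemma finite_poly_coeff_zero_from:
  "finite {g :: 'a::{field,finite} poly. \<forall>i\<ge>d. Polynomial.coeff g i = 0}"
  by (rule card_ge_0_finite) (simp add: card_poly_coeff_zero_from)

lemma monic_polys_eq:
  "(monic_polys d :: 'a::{field,finite} poly set) =
     (\<lambda>g. Polynomial.monom 1 d + g) ` {g. \<forall>i\<ge>d. Polynomial.coeff g i = 0}"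
proof (intro equalityI subsetI)
  fix f :: "'a poly" assume f: "f \<in> monic_polys d"
  have "\<forall>i\<ge>d. Polynomial.coeff (f - Polynomial.monom 1 d) i = 0"
    using f by (auto simp: monic_polys_def le_less coeff_eq_0)
  moreover have "f = Polynomial.monom 1 d + (f - Polynomial.monom 1 d)" by simp
  ultimately show "f \<in> (\<lambda>g. Polynomial.monom 1 d + g) ` {g. \<forall>i\<ge>d. Polynomial.coeff g i = 0}"
    by blast
next
  fix f :: "'a poly"
  assume "f \<in> (\<lambda>g. Polynomial.monom 1 d + g) ` {g. \<forall>i\<ge>d. Polynomial.coeff g i = 0}"
  then obtain g where g: "f = Polynomial.monom 1 d + g" "\<forall>i\<ge>d. Polynomial.coeff g i = 0" by blast
  have "Polynomial.coeff f d = 1" "\<forall>i>d. Polynomial.coeff f i = 0" using g by auto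
  moreover from this have "Polynomial.degree f = d"
    by (intro antisym degree_le le_degree) auto
  ultimately show "f \<in> monic_polys d" by (simp add: monic_polys_def)
qed

lemma card_monic_polys: "card (monic_polys d :: 'a::{field,finite} poly set) = CARD('a) ^ d"
  unfolding monic_polys_eq by (subst card_image) (auto simp: card_poly_coeff_zero_from)

lemma finite_monic_polys: "finite (monic_polys d :: 'a::{field,finite} poly set)"
  unfolding monic_polys_eq by (intro finite_imageI finite_poly_coeff_zero_from)

lemma monic_irreduciblesD:
  assumes "p \<in> monic_irreducibles"
  shows "Polynomial.lead_coeff p = 1" "Factorial_Ring.irreducible p" "prime_elem p" "p \<noteq> 0"
    "Polynomial.degree p > 0" "\<not> is_unit p"
proof -
  show *: "Polynomial.lead_coeff p = 1" "Factorial_Ring.irreducible p"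
    using assms by (auto simp: monic_irreducibles_def)
  show "prime_elem p" using * by (intro field_poly_irreducible_imp_prime)
  show "p \<noteq> 0" using * by auto
  show u: "\<not> is_unit p" using * irreducible_not_unit by blast
  show "Polynomial.degree p > 0" using u \<open>p \<noteq> 0\<close> is_unit_iff_degree by blast
qed

text \<open>Irreducibility turns one divisibility into two, so the cofactor is a constant; comparing
  leading coefficients makes it 1.\<close>

lemma monic_irreducibles_dvd_imp_eq:
  assumes "p \<in> monic_irreducibles" "p' \<in> monic_irreducibles" "p dvd p'"
  shows "p = p'"
proof -
  have "p' dvd p"
    using assms irreducibleD' monic_irreduciblesD by blast
  obtain k where k: "p' = p * k" using assms(3) by (rule dvdE)
  have nz: "p \<noteq> 0" "p' \<noteq> 0" using assms monic_irreduciblesD(4) by auto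
  hence "k \<noteq> 0" "Polynomial.degree p' \<le> Polynomial.degree p"
    using k \<open>p' dvd p\<close> by (auto intro: dvd_imp_degree_le)
  hence "Polynomial.degree k = 0" using nz k by (simp add: degree_mult_eq)
  then obtain c where "k = [:c:]" by (rule degree_eq_zeroE)
  moreover have "Polynomial.lead_coeff k = 1"
    using lead_coeff_mult[of p k] k monic_irreduciblesD(1)[OF assms(1)]
      monic_irreduciblesD(1)[OF assms(2)] by simp
  ultimately show ?thesis using k by (simp add: one_pCons)
qed

lemma ex_monic_irreducible_dvd:
  fixes f :: "'a::{field,finite} poly"
  assumes "Polynomial.degree f > 0"
  shows "\<exists>p\<in>monic_irreducibles. p dvd f"
  using assms
proof (induction "Polynomial.degree f" arbitrary: f rule: less_induct)
  case less
  hence nz: "f \<noteq> 0" by auto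
  show ?case
  proof (cases "Factorial_Ring.irreducible f")
    case True
    define c where "c = inverse (Polynomial.lead_coeff f)"
    have c: "c \<noteq> 0" using nz by (simp add: c_def)
    have "Factorial_Ring.irreducible ([:c:] * f)"
      by (subst irreducible_mult_unit_left) (use True c in \<open>auto simp: is_unit_triv\<close>)
    hence "Polynomial.smult c f \<in> monic_irreducibles"
      using nz by (simp add: monic_irreducibles_def c_def)
    moreover have "Polynomial.smult c f dvd f" using c by (simp add: smult_dvd)
    ultimately show ?thesis by blast
  next
    case False
    have "\<not> is_unit f" using less.prems nz by (simp add: is_unit_iff_degree)
    then obtain a b where ab: "f = a * b" "\<not> is_unit a" "\<not> is_unit b"
      using False nz by (auto simp: Factorial_Ring.irreducible_def)
    with nz have "a \<noteq> 0" "b \<noteq> 0" by auto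
    hence "Polynomial.degree a > 0" "Polynomial.degree b > 0" "Polynomial.degree f
        = Polynomial.degree a + Polynomial.degree b"
      using ab by (auto simp: is_unit_iff_degree degree_mult_eq)
    with less.hyps[of a] obtain p where "p \<in> monic_irreducibles" "p dvd a" by auto
    thus ?thesis using ab dvd_mult2 by blast
  qed
qed

definition prime_divs :: "'a::{field,finite} poly \<Rightarrow> 'a poly set" where
  "prime_divs f = {p \<in> monic_irreducibles. p dvd f}"

lemma finite_prime_divs:
  fixes f :: "'a::{field,finite} poly"
  assumes "f \<noteq> 0"
  shows "finite (prime_divs f)"
proof (rule finite_subset)
  show "prime_divs f \<subseteq> {g. \<forall>i\<ge>Suc (Polynomial.degree f). Polynomial.coeff g i = 0}"
    using assms by (auto simp: prime_divs_def intro!: coeff_eq_0 dest!: dvd_imp_degree_le)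
qed (rule finite_poly_coeff_zero_from)


subsection \<open>Evaluation in the algebraic closure\<close>

definition ac_eval :: "'a::{field,finite} alg_closure \<Rightarrow> 'a poly \<Rightarrow> 'a alg_closure" where
  "ac_eval x g = poly (map_poly to_ac g) x"

lemma ac_eval_0 [simp]: "ac_eval x 0 = 0"
  by (simp add: ac_eval_def)

lemma ac_eval_pCons [simp]: "ac_eval x (pCons c g) = to_ac c + x * ac_eval x g"
  by (simp add: ac_eval_def map_poly_pCons)

lemma ac_eval_add [simp]: "ac_eval x (f + g) = ac_eval x f + ac_eval x g"
  by (induction f g rule: poly_induct2) (auto simp: algebra_simps)

lemma ac_eval_smult [simp]: "ac_eval x (Polynomial.smult c g) = to_ac c * ac_eval x g"
  by (induction g) (auto simp: algebra_simps)

lemma ac_eval_mult [simp]: "ac_eval x (f * g) = ac_eval x f * ac_eval x g"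
  by (induction f) (auto simp: algebra_simps)

lemma ac_eval_diff [simp]: "ac_eval x (f - g) = ac_eval x f - ac_eval x g"
  using ac_eval_add[of x "f - g" g] by (simp add: algebra_simps)

lemma ac_eval_mod: "ac_eval x p = 0 \<Longrightarrow> ac_eval x (g mod p) = ac_eval x g"
proof -
  assume "ac_eval x p = 0"
  moreover have "ac_eval x g = ac_eval x (g div p * p + g mod p)" by simp
  ultimately show ?thesis unfolding ac_eval_add ac_eval_mult by simp
qed

lemma degree_map_to_ac [simp]: "Polynomial.degree (map_poly to_ac g) = Polynomial.degree g"
  by (rule degree_map_poly) auto

lemma finite_ac_roots: 
  assumes "g \<noteq> 0" shows "finite {x. ac_eval x g = 0}"
  unfolding ac_eval_def by (rule poly_roots_finite) (use assms in \<open>simp add: map_poly_eq_0_iff\<close>)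

lemma card_ac_roots_le: 
  assumes "g \<noteq> 0" shows "card {x. ac_eval x g = 0} \<le> Polynomial.degree g"
  unfolding ac_eval_def using card_poly_roots_bound[of "map_poly to_ac g"] assms
  by (simp add: map_poly_eq_0_iff)

lemma ex_ac_root: "Polynomial.degree g > 0 \<Longrightarrow> \<exists>x. ac_eval x g = 0"
  unfolding ac_eval_def by (rule alg_closed_imp_poly_has_root) simp

text \<open>
  The difference of the two sides is a polynomial in \<open>x\<close> of degree less than \<open>q\<close> that vanishes on \<open>\<F>\<^sub>q\<close>.
\<close>
lemma frobenius_add_1:
  fixes x :: "'a::{field,finite} alg_closure"
  shows "(1 + x) ^ CARD('a) = 1 + x ^ CARD('a)"
proof -
  define q where "q = CARD('a)"
  have q: "q \<ge> 2" unfolding q_def by (rule card_field_ge_2)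
  define P where "P = [:1, 1 :: 'a alg_closure:] ^ q - Polynomial.monom 1 q - 1"
  have ev: "poly P x = (1 + x) ^ q - (1 + x ^ q)" for x
    by (simp add: P_def poly_monom)
  have deg: "Polynomial.degree ([:1, 1 :: 'a alg_closure:] ^ q) = q"
    by (simp add: degree_power_eq)
  have "Polynomial.coeff ([:1, 1 :: 'a alg_closure:] ^ q) q = 1"
    using deg lead_coeff_power[of "[:1, 1 :: 'a alg_closure:]" q] by simp
  hence c: "Polynomial.coeff P q = 0" using q by (simp add: P_def)
  have "Polynomial.degree P \<le> q"
    unfolding P_def using deg by (intro degree_diff_le) (auto simp: degree_monom_eq)
  have "P = 0"
  proof (rule ccontr)
    assume nz: "P \<noteq> 0"
    have lt: "Polynomial.degree P < q"
      using c \<open>Polynomial.degree P \<le> q\<close> nz by (metis le_neq_implies_less leading_coeff_0_iff)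
    have "range to_ac \<subseteq> {x. poly P x = 0}"
    proof
      fix x assume "x \<in> range (to_ac :: 'a \<Rightarrow> _)"
      then obtain c :: 'a where x: "x = to_ac c" by blast
      have "(1 + to_ac c) ^ q = to_ac ((1 + c) ^ q)" by simp
      also have "\<dots> = 1 + to_ac c ^ q"
        unfolding q_def by (simp add: power_card_field flip: to_ac_power)
      finally show "x \<in> {x. poly P x = 0}" by (simp add: ev x)
    qed
    hence "card (range (to_ac :: 'a \<Rightarrow> _)) \<le> card {x. poly P x = 0}"
      by (intro card_mono poly_roots_finite nz)
    also have "\<dots> \<le> Polynomial.degree P" by (rule card_poly_roots_bound[OF nz])
    also have "\<dots> < q" by (rule lt)
    finally show False by (simp add: q_def card_image inj_to_ac)
  qed
  thus ?thesis using ev[of x] by (simp add: q_def)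
qed

text \<open>The case m = 1 follows from the identity for 1 + x by homogeneity, writing x + y = x (1
  + y/x); the general case iterates it.\<close>

lemma frobenius_add:
  fixes x y :: "'a::{field,finite} alg_closure"
  shows "(x + y) ^ (CARD('a) ^ m) = x ^ (CARD('a) ^ m) + y ^ (CARD('a) ^ m)"
proof -
  have 1: "(x + y) ^ CARD('a) = x ^ CARD('a) + y ^ CARD('a)" for x y :: "'a alg_closure"
  proof (cases "x = 0")
    case False
    hence "x + y = x * (1 + y / x)" by (simp add: field_simps)
    hence "(x + y) ^ CARD('a) = x ^ CARD('a) * (1 + (y / x) ^ CARD('a))"
      using frobenius_add_1 by (metis power_mult_distrib)
    thus ?thesis using False by (simp add: field_simps)
  qed (simp add: power_0_left)
  show ?thesis
    by (induction m) (simp_all add: power_mult 1 mult.commute[of "CARD('a)"])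
qed

lemma frobenius_to_ac: "to_ac (c::'a::{field,finite}) ^ (CARD('a) ^ m) = to_ac c"
proof (induction m)
  case (Suc m)
  have "to_ac c ^ (CARD('a) ^ Suc m) = (to_ac (c ^ CARD('a))) ^ (CARD('a) ^ m)"
    by (simp add: power_mult)
  thus ?case using Suc by (simp only: power_card_field)
qed simp

text \<open>Frobenius is a ring homomorphism that fixes the coefficients, which lie in the base
  field. In particular it maps roots of \<open>g\<close> to roots of \<open>g\<close>.\<close>

lemma ac_eval_frobenius:
  fixes x :: "'a::{field,finite} alg_closure"
  shows "ac_eval (x ^ (CARD('a) ^ m)) g = ac_eval x g ^ (CARD('a) ^ m)"
  by (induction g) (simp_all add: frobenius_add frobenius_to_ac power_mult_distrib power_0_left)

lemma frobenius_inj: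
  fixes x y :: "'a::{field,finite} alg_closure"
  assumes "x ^ (CARD('a) ^ m) = y ^ (CARD('a) ^ m)"
  shows "x = y"
proof -
  have "(x - y) ^ (CARD('a) ^ m) = 0"
    using frobenius_add[of "x - y" y m] assms by simp
  thus ?thesis by simp
qed

section \<open>Roots of a monic irreducible polynomial and their Frobenius orbits\<close>

context
  fixes p :: "'a::{field,finite} poly" and x :: "'a alg_closure"
  assumes p: "p \<in> monic_irreducibles" and px: "ac_eval x p = 0"
begin

text \<open>Minimal polynomial argument: a nonzero \<open>m\<close> of least degree vanishing at
  \<open>x\<close> divides \<open>p\<close>, because the remainder of \<open>p\<close> modulo
  \<open>m\<close> vanishes at \<open>x\<close> too. As \<open>m\<close> is not a unit,
  irreducibility gives that \<open>p\<close> divides \<open>m\<close>, so nothing nonzero of degree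
  below that of \<open>p\<close> vanishes at \<open>x\<close>.\<close>

lemma ac_eval_eq_0_low_degree:
  assumes "ac_eval x g = 0" "Polynomial.degree g < Polynomial.degree p"
  shows "g = 0"
proof (rule ccontr)
  assume "g \<noteq> 0"
  define m where "m = (ARG_MIN Polynomial.degree h. h \<noteq> 0 \<and> ac_eval x h = 0)"
  have m: "m \<noteq> 0" "ac_eval x m = 0"
    and min: "\<And>h. h \<noteq> 0 \<Longrightarrow> ac_eval x h = 0 \<Longrightarrow> Polynomial.degree m \<le> Polynomial.degree h"
    using arg_min_nat_lemma[of "\<lambda>h. h \<noteq> 0 \<and> ac_eval x h = 0" g Polynomial.degree]
      assms(1) \<open>g \<noteq> 0\<close> unfolding m_def by auto
  have "ac_eval x (p mod m) = 0" using px m by (simp add: ac_eval_mod)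
  hence "p mod m = 0" using min[of "p mod m"] degree_mod_less[OF m(1), of p] by fastforce
  hence "m dvd p" by auto
  moreover have "\<not> is_unit m"
  proof
    assume "is_unit m"
    then obtain a where "m = [:a:]" "a \<noteq> 0" by (metis is_unit_polyE' monom_0)
    thus False using m by simp
  qed
  ultimately have "p dvd m" using irreducibleD' monic_irreduciblesD(2)[OF p] by blast
  hence "Polynomial.degree p \<le> Polynomial.degree m" using m by (intro dvd_imp_degree_le)
  also have "\<dots> \<le> Polynomial.degree g" using min assms \<open>g \<noteq> 0\<close> by blast
  finally show False using assms by simp
qed

lemma ac_eval_eq_0_iff: "ac_eval x g = 0 \<longleftrightarrow> p dvd g"
proof
  assume *: "ac_eval x g = 0"
  have "ac_eval x (g mod p) = 0" using * px by (simp add: ac_eval_mod)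
  hence "g mod p = 0"
    using ac_eval_eq_0_low_degree degree_mod_less[OF monic_irreduciblesD(4)[OF p], of g] by blast
  thus "p dvd g" by auto
qed (use px in auto)

text \<open>The set \<open>K\<close> below is the field generated by \<open>x\<close>, with q^d
  elements represented by polynomials of degree less than d. The d-th power of Frobenius is the
  identity on \<open>K\<close>, by the permutation argument for finite multiplicatively closed sets.
  Conversely, no b-th power with 0 < b < d can be, because T^(q^b) - T has too few roots.\<close>

lemma frobenius_fixes_root_iff:
  "x ^ (CARD('a) ^ m) = x \<longleftrightarrow> Polynomial.degree p dvd m"
proof -
  define q where "q = CARD('a)"
  have q: "q \<ge> 2" unfolding q_def by (rule card_field_ge_2)
  define d where "d = Polynomial.degree p"
  have d: "d > 0" using monic_irreduciblesD(5)[OF p] by (simp add: d_def)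
  define G where "G = {g :: 'a poly. \<forall>i\<ge>d. Polynomial.coeff g i = 0}"
  have G: "g \<in> G \<longleftrightarrow> Polynomial.degree g < d" for g
    using d degree_lessI[of g d] by (auto simp: G_def intro: coeff_eq_0)
  define K where "K = ac_eval x ` G"
  have "inj_on (ac_eval x) G"
  proof (rule inj_onI)
    fix g h assume *: "g \<in> G" "h \<in> G" "ac_eval x g = ac_eval x h"
    have "g - h = 0"
      by (rule ac_eval_eq_0_low_degree) (use * G in \<open>auto simp: d_def intro: degree_diff_less\<close>)
    thus "g = h" by simp
  qed
  hence card: "card K = q ^ d"
    unfolding K_def q_def by (subst card_image) (auto simp: G_def card_poly_coeff_zero_from)
  have fin: "finite K" unfolding K_def G_def by (intro finite_imageI finite_poly_coeff_zero_from)
  have K: "ac_eval x g \<in> K" for g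
  proof -
    have "Polynomial.degree (g mod p) < d" 
      using degree_mod_less[OF monic_irreduciblesD(4)[OF p], of g] d by (auto simp: d_def)
    thus ?thesis using px G by (auto simp: K_def ac_eval_mod intro!: image_eqI[where x = "g mod p"])
  qed
  have K': "\<exists>g. y = ac_eval x g" if "y \<in> K" for y using that by (auto simp: K_def)
  have fix_d: "y ^ (q ^ d) = y" if "y \<in> K" for y
    unfolding card[symmetric]
  proof (rule finite_mult_closed_power_card[OF fin])
    show "0 \<in> K" using K[of 0] by simp
    show "y * z \<in> K" if "y \<in> K" "z \<in> K" for y z
    proof -
      obtain g where "y = ac_eval x g" using K'[OF \<open>y \<in> K\<close>] by blast
      moreover obtain h where "z = ac_eval x h" using K'[OF \<open>z \<in> K\<close>] by blast
      ultimately show ?thesis using K[of "g * h"] by simp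
    qed
  qed fact
  have fix_dk: "y ^ (q ^ (d * k)) = y" if "y \<in> K" for y k
  proof (induction k)
    case (Suc k)
    have "y ^ (q ^ (d * Suc k)) = (y ^ (q ^ d)) ^ (q ^ (d * k))"
      by (simp add: power_add power_mult)
    thus ?case using Suc fix_d[OF that] by simp
  qed simp
  have xK: "x \<in> K" using K[of "[:0, 1:]"] by simp
  have "d dvd m" if *: "x ^ (q ^ m) = x"
  proof (rule ccontr)
    assume "\<not> d dvd m"
    define b where "b = m mod d"
    have b: "b > 0" "b < d" using \<open>\<not> d dvd m\<close> d by (auto simp: b_def dvd_eq_mod_eq_0)
    \<comment> \<open>Elements of \<open>K\<close> are polynomial expressions in \<open>x\<close>,
      so the m-th power of Frobenius fixes all of \<open>K\<close> once it fixes \<open>x\<close>.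
      The part of m divisible by d acts trivially, which leaves the exponent
      \<open>b\<close>.\<close>
    have y: "y ^ (q ^ b) = y" if "y \<in> K" for y
    proof -
      obtain g where g: "y = ac_eval x g" using K'[OF \<open>y \<in> K\<close>] by blast
      have "ac_eval (x ^ (q ^ m)) g = y ^ (q ^ m)" unfolding g q_def by (rule ac_eval_frobenius)
      hence "y = y ^ (q ^ m)" unfolding * g .
      also have "\<dots> = (y ^ (q ^ (d * (m div d)))) ^ (q ^ b)"
        unfolding b_def power_mult [symmetric] power_add [symmetric] mult_div_mod_eq ..
      also have "\<dots> = y ^ (q ^ b)" unfolding fix_dk[OF \<open>y \<in> K\<close>] ..
      finally show ?thesis ..
    qed
    define P :: "'a alg_closure poly" where "P = Polynomial.monom 1 (q ^ b) - Polynomial.monom 1 1"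
    have qb: "q ^ b > 1" using q b by (intro one_less_power) auto
    have "Polynomial.coeff P (q ^ b) = 1" using qb by (simp add: P_def)
    hence nz: "P \<noteq> 0" by auto
    have "Polynomial.degree P \<le> q ^ b"
      unfolding P_def using qb by (intro degree_diff_le) (auto simp: degree_monom_eq)
    have "K \<subseteq> {y. poly P y = 0}" using y by (auto simp: P_def poly_monom)
    hence "card K \<le> card {y. poly P y = 0}" by (intro card_mono poly_roots_finite nz)
    also have "\<dots> \<le> q ^ b"
      using card_poly_roots_bound[OF nz] \<open>Polynomial.degree P \<le> q ^ b\<close> by linarith
    also have "\<dots> < q ^ d" using b q by (intro power_strict_increasing) auto
    finally show False using card by simp
  qed
  moreover have "x ^ (q ^ m) = x" if "d dvd m" 
    using that by (elim dvdE) (simp only: fix_dk[OF xK])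
  ultimately show ?thesis unfolding q_def d_def by (rule iffI)
qed

end

text \<open>Separability, shown by exhibiting d distinct conjugates x^(q^i) with i < d. If two of
  them agreed, cancelling the injective i-th power of Frobenius would make d divide j - i, although
  0 < j - i < d.\<close>

lemma card_ac_roots_irreducible:
  fixes p :: "'a::{field,finite} poly"
  assumes p: "p \<in> monic_irreducibles"
  shows "card {x. ac_eval x p = 0} = Polynomial.degree p"
proof (rule antisym)
  define d where "d = Polynomial.degree p"
  obtain x where x: "ac_eval x p = 0" using ex_ac_root[OF monic_irreduciblesD(5)[OF p]] ..
  have *: False if "i < j" "j < d" "x ^ (CARD('a) ^ i) = x ^ (CARD('a) ^ j)" for i j
  proof -
    have eq: "x ^ (CARD('a) ^ j) = (x ^ (CARD('a) ^ (j - i))) ^ (CARD('a) ^ i)"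
      unfolding power_mult [symmetric] power_add [symmetric] using that(1) by simp
    have "x ^ (CARD('a) ^ (j - i)) = x"
      by (rule frobenius_inj[where m = i], rule trans[OF eq[symmetric] that(3)[symmetric]])
    hence "d dvd j - i" using frobenius_fixes_root_iff[OF p x] by (simp add: d_def)
    thus False using that by (auto dest: dvd_imp_le)
  qed
  have "inj_on (\<lambda>i. x ^ (CARD('a) ^ i)) {..<d}"
    by (rule linorder_inj_onI) (use * in auto)
  hence "d = card ((\<lambda>i. x ^ (CARD('a) ^ i)) ` {..<d})" by (simp add: card_image)
  also have "\<dots> \<le> card {x. ac_eval x p = 0}"
    by (intro card_mono finite_ac_roots monic_irreduciblesD(4)[OF p])
       (auto simp: ac_eval_frobenius x power_0_left)
  finally show "Polynomial.degree p \<le> card {x. ac_eval x p = 0}" by (simp add: d_def)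
qed (use card_ac_roots_le[OF monic_irreduciblesD(4)[OF p]] in simp)

lemma ac_root_prime_divs:
  fixes f :: "'a::{field,finite} poly"
  assumes "f \<noteq> 0" "ac_eval x f = 0"
  shows "\<exists>p\<in>prime_divs f. ac_eval x p = 0"
  using assms
proof (induction "Polynomial.degree f" arbitrary: f rule: less_induct)
  case less
  have "Polynomial.degree f > 0"
  proof (rule ccontr)
    assume "\<not> Polynomial.degree f > 0"
    hence "Polynomial.degree f = 0" by simp
    then obtain a where "f = [:a:]" by (rule degree_eq_zeroE)
    thus False using less.prems by simp
  qed
  then obtain p g where p: "p \<in> monic_irreducibles" "f = p * g"
    using ex_monic_irreducible_dvd by (metis dvdE)
  show ?case
  proof (cases "ac_eval x p = 0")
    case False
    have "g \<noteq> 0" "p \<noteq> 0" using p less.prems by auto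
    have "Polynomial.degree g < Polynomial.degree f"
      using p monic_irreduciblesD(5)[OF p(1)] \<open>g \<noteq> 0\<close> \<open>p \<noteq> 0\<close> by (simp add: degree_mult_eq)
    moreover have "ac_eval x g = 0" using False p less.prems by simp
    ultimately obtain p' where "p' \<in> prime_divs g" "ac_eval x p' = 0"
      using less.hyps \<open>g \<noteq> 0\<close> by blast
    thus ?thesis using p by (auto simp: prime_divs_def)
  qed (use p in \<open>auto simp: prime_divs_def\<close>)
qed

text \<open>The roots of \<open>f\<close> are partitioned by the prime divisor that they annul; two
  primes sharing a root divide one another and are equal. Within one class either all deg p roots
  are fixed or none is. Multiplicities in \<open>f\<close> do not matter because only the set of
  roots is counted.\<close>

lemma card_fixed_ac_roots:
  fixes f :: "'a::{field,finite} poly"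
  assumes f: "f \<noteq> 0"
  shows "card {x. ac_eval x f = 0 \<and> x ^ (CARD('a) ^ m) = x} =
           (\<Sum>p\<in>prime_divs f. if Polynomial.degree p dvd m then Polynomial.degree p else 0)"
proof -
  define R where "R p = {x. ac_eval x p = 0 \<and> x ^ (CARD('a) ^ m) = x}" for p :: "'a poly"
  have cardR: "card (R p) = (if Polynomial.degree p dvd m then Polynomial.degree p else 0)"
    if p: "p \<in> monic_irreducibles" for p
  proof (cases "Polynomial.degree p dvd m")
    case True
    hence "R p = {x. ac_eval x p = 0}" using frobenius_fixes_root_iff[OF p] by (auto simp: R_def)
    thus ?thesis using True card_ac_roots_irreducible[OF p] by simp
  next
    case False
    hence "R p = {}" using frobenius_fixes_root_iff[OF p] by (auto simp: R_def)
    thus ?thesis using False by simp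
  qed
  have "R f = (\<Union>p\<in>prime_divs f. R p)"
  proof (intro equalityI subsetI)
    fix x assume "x \<in> R f"
    thus "x \<in> (\<Union>p\<in>prime_divs f. R p)" using ac_root_prime_divs[OF f, of x] by (auto simp: R_def)
  next
    fix x assume "x \<in> (\<Union>p\<in>prime_divs f. R p)"
    thus "x \<in> R f" by (auto simp: R_def prime_divs_def elim!: dvdE)
  qed
  hence "card (R f) = card (\<Union>p\<in>prime_divs f. R p)" by simp
  also have "\<dots> = (\<Sum>p\<in>prime_divs f. card (R p))"
  proof (rule card_UN_disjoint)
    show "finite (prime_divs f)" by (rule finite_prime_divs[OF f])
    show "\<forall>p\<in>prime_divs f. finite (R p)"
    proof
      fix p assume "p \<in> prime_divs f"
      hence "p \<noteq> 0" using monic_irreduciblesD(4) by (auto simp: prime_divs_def)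
      from finite_ac_roots[OF this] show "finite (R p)"
        by (rule finite_subset[rotated]) (auto simp: R_def)
    qed
    show "\<forall>p\<in>prime_divs f. \<forall>p'\<in>prime_divs f. p \<noteq> p' \<longrightarrow> R p \<inter> R p' = {}"
    proof (intro ballI impI, rule ccontr)
      fix p p' assume *: "p \<in> prime_divs f" "p' \<in> prime_divs f" "p \<noteq> p'" "R p \<inter> R p' \<noteq> {}"
      then obtain x where "ac_eval x p = 0" "ac_eval x p' = 0" by (auto simp: R_def)
      with * have "p dvd p'" using ac_eval_eq_0_iff[of p x p'] by (simp add: prime_divs_def)
      with * show False using monic_irreducibles_dvd_imp_eq[of p p'] by (simp add: prime_divs_def)
    qed
  qed
  also have "\<dots> = (\<Sum>p\<in>prime_divs f. if Polynomial.degree p dvd m then Polynomial.degree p else 0)"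
    by (intro sum.cong refl cardR) (auto simp: prime_divs_def)
  finally show ?thesis by (simp add: R_def)
qed


subsection \<open>Points of \<open>X\<^sub>f\<close>\<close>

lemma poly_ideal_eq: "poly_ideal f = {g. f dvd g}"
proof -
  interpret cring "ring_of_type_algebra :: 'a poly ring" by (rule cring_from_type_algebra)
  have "poly_ideal f = PIdl\<^bsub>ring_of_type_algebra\<^esub> f"
    unfolding poly_ideal_def
      by (rule cgenideal_eq_genideal[symmetric]) (simp add: ring_of_type_algebra_def)
  thus ?thesis by (auto simp: cgenideal_def ring_of_type_algebra_def dvd_def mult.commute)
qed

lemma ideal_poly_ideal: "ideal (poly_ideal f) ring_of_type_algebra"
  unfolding poly_ideal_def
  by (intro ring.genideal_ideal comm_ring_1_class.ring_from_type_algebra) (simp add: ring_of_type_algebra_def)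

definition residue_class :: "'a::{field,finite} poly \<Rightarrow> 'a poly \<Rightarrow> 'a poly set" where
  "residue_class f g = poly_ideal f +>\<^bsub>ring_of_type_algebra\<^esub> g"

lemma residue_class_eq: "residue_class f g = {k. f dvd k - g}"
proof -
  have "residue_class f g = {h + g | h. f dvd h}"
    by (auto simp: residue_class_def a_r_coset_def' poly_ideal_eq ring_of_type_algebra_def)
  also have "\<dots> = {k. f dvd k - g}"
    by (auto intro: exI[of _ "k - g" for k])
  finally show ?thesis .
qed

lemma residue_class_eq_iff: "residue_class f g = residue_class f h \<longleftrightarrow> f dvd g - h"
proof
  assume "residue_class f g = residue_class f h"
  moreover have "g \<in> residue_class f g" by (simp add: residue_class_eq)
  ultimately show "f dvd g - h" by (simp add: residue_class_eq)
next
  assume *: "f dvd g - h"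
  have "f dvd k - g \<longleftrightarrow> f dvd k - h" for k
    using dvd_add_left_iff[OF *, of "k - g"] by simp
  thus "residue_class f g = residue_class f h" by (simp add: residue_class_eq)
qed

lemma carrier_coord_ring: "carrier (coord_ring f) = range (residue_class f)"
  by (auto simp: coord_ring_def FactRing_def A_RCOSETS_def' residue_class_def ring_of_type_algebra_def)

lemma coord_ring_mult:
  "residue_class f g \<otimes>\<^bsub>coord_ring f\<^esub> residue_class f h = residue_class f (g * h)"
  using ideal.rcoset_mult_add[OF ideal_poly_ideal, of g h f]
  by (simp add: coord_ring_def FactRing_def residue_class_def ring_of_type_algebra_def)

lemma coord_ring_add:
  "residue_class f g \<oplus>\<^bsub>coord_ring f\<^esub> residue_class f h = residue_class f (g + h)"
  using abelian_subgroup.a_rcos_sum[OF abelian_subgroupI3[OF ideal.axioms(1)[OF ideal_poly_ideal]], of g h f]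
    ring.is_abelian_group[OF comm_ring_1_class.ring_from_type_algebra]
  by (simp add: coord_ring_def FactRing_def residue_class_def ring_of_type_algebra_def)

lemma coord_ring_one: "\<one>\<^bsub>coord_ring f\<^esub> = residue_class f 1"
  by (simp add: coord_ring_def FactRing_def residue_class_def ring_of_type_algebra_def)

lemma coord_const_eq: "coord_const f c = residue_class f [:c:]"
  by (simp add: coord_const_def residue_class_def)

text \<open>The homomorphism conditions are pulled back along the surjection
  \<open>residue_class f\<close>, so that points can be handled through polynomials. Preservation of
  1 is contained in the last condition, at c = 1.\<close>

lemma X_points_eq:
  "X_points f m = {\<phi> \<in> extensional (range (residue_class f)).
      (\<forall>g. \<phi> (residue_class f g) ^ (CARD('a::{field,finite}) ^ m) = \<phi> (residue_class f g)) \<and>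
      (\<forall>g h. \<phi> (residue_class f (g * h)) = \<phi> (residue_class f g) * \<phi> (residue_class f h)) \<and>
      (\<forall>g h. \<phi> (residue_class f (g + h)) = \<phi> (residue_class f g) + \<phi> (residue_class f h)) \<and>
      (\<forall>c::'a. \<phi> (residue_class f [:c:]) = to_ac c)}"
  (is "_ = ?R")
proof -
  have 1: "\<phi> (residue_class f 1) = 1" if "\<forall>c. \<phi> (residue_class f [:c:]) = to_ac c" for \<phi>
    using spec[OF that, of 1] by (simp add: one_pCons)
  have 2: "(\<forall>x y. x \<in> range F \<and> y \<in> range F \<longrightarrow> P x y) \<longleftrightarrow> (\<forall>g h. P (F g) (F h))"
    for F :: "'a poly \<Rightarrow> 'a poly set" and P
    by blast
  have "\<phi> \<in> X_points f m \<longleftrightarrow> \<phi> \<in> ?R" for \<phi>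
    unfolding X_points_def Ring.ring_hom_def carrier_coord_ring coord_ring_one coord_const_eq
      mem_Collect_eq Int_iff 2 coord_ring_mult coord_ring_add
    using 1[of \<phi>]
    by (auto simp: Pi_iff ext_field_def ring_of_type_algebra_def)
  thus ?thesis by blast
qed

text \<open>An algebra homomorphism out of a quotient of the polynomial ring is evaluation at the
  image of the class of the variable; the induction follows the Horner scheme.\<close>

lemma X_points_eval:
  assumes "\<phi> \<in> X_points f m"
  shows "\<phi> (residue_class f g) = ac_eval (\<phi> (residue_class f [:0, 1:])) g"
proof (induction g)
  case 0
  have "\<phi> (residue_class f [:0:]) = to_ac 0" using assms unfolding X_points_eq by blast
  thus ?case by simp
next
  case (pCons c g)
  have "\<phi> (residue_class f (pCons c g)) = \<phi> (residue_class f ([:c:] + [:0, 1:] * g))" by simp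
  also have "\<dots> = to_ac c + \<phi> (residue_class f [:0, 1:]) * \<phi> (residue_class f g)"
    using assms unfolding X_points_eq by (simp del: mult_pCons_left add_pCons)
  finally show ?case by (simp add: pCons)
qed

text \<open>Universal property of the quotient: a point is determined by the image of the class of
  the variable, and that image can be any root of \<open>f\<close> in the extension field.
  Injectivity uses extensionality, which fixes the values off the carrier.\<close>

lemma card_X_points:
  fixes f :: "'a::{field,finite} poly"
  shows "card (X_points f m) = card {x. ac_eval x f = 0 \<and> x ^ (CARD('a) ^ m) = x}"
proof -
  define R where "R = {x. ac_eval x f = 0 \<and> x ^ (CARD('a) ^ m) = x}"
  have "bij_betw (\<lambda>\<phi>. \<phi> (residue_class f [:0, 1:])) (X_points f m) R"
    unfolding bij_betw_def
  proof
    show "inj_on (\<lambda>\<phi>. \<phi> (residue_class f [:0, 1:])) (X_points f m)"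
    proof (rule inj_onI)
      fix \<phi> \<psi>
      assume *: "\<phi> \<in> X_points f m" "\<psi> \<in> X_points f m"
        "\<phi> (residue_class f [:0, 1:]) = \<psi> (residue_class f [:0, 1:])"
      show "\<phi> = \<psi>"
      proof (rule extensionalityI)
        show "\<phi> \<in> extensional (range (residue_class f))" "\<psi> \<in> extensional (range (residue_class f))"
          using * by (simp_all add: X_points_eq)
        fix c assume "c \<in> range (residue_class f)"
        then obtain g where "c = residue_class f g" by blast
        thus "\<phi> c = \<psi> c"
          using X_points_eval[OF *(1), of g] X_points_eval[OF *(2), of g] *(3) by metis
      qed
    qed
    show "(\<lambda>\<phi>. \<phi> (residue_class f [:0, 1:])) ` X_points f m = R"
    proof (intro equalityI subsetI)
      fix x assume "x \<in> (\<lambda>\<phi>. \<phi> (residue_class f [:0, 1:])) ` X_points f m"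
      then obtain \<phi> where \<phi>: "\<phi> \<in> X_points f m" "x = \<phi> (residue_class f [:0, 1:])" by blast
      have "ac_eval x f = \<phi> (residue_class f f)"
        unfolding \<phi>(2) by (rule X_points_eval[OF \<phi>(1), symmetric])
      also have "residue_class f f = residue_class f 0" by (simp add: residue_class_eq_iff)
      also have "\<phi> \<dots> = 0" using X_points_eval[OF \<phi>(1), of 0] by simp
      finally show "x \<in> R" using \<phi> by (simp add: R_def X_points_eq)
    next
      fix x assume x: "x \<in> R"
      \<comment> \<open>The arbitrary choice of a representative is harmless: two choices differ by
        a multiple of \<open>f\<close>, which vanishes at \<open>x\<close>.\<close>
      define \<phi> where "\<phi> = restrict (\<lambda>c. ac_eval x (SOME g. c
          = residue_class f g)) (range (residue_class f))"
      have ev: "\<phi> (residue_class f g) = ac_eval x g" for g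
      proof -
        define h where "h = (SOME h. residue_class f g = residue_class f h)"
        have "residue_class f g = residue_class f h" unfolding h_def by (rule someI) (rule refl)
        hence "f dvd g - h" by (simp add: residue_class_eq_iff)
        hence "ac_eval x (g - h) = 0"
          using x by (auto simp: R_def elim!: dvdE simp del: ac_eval_diff)
        thus ?thesis by (simp add: \<phi>_def h_def)
      qed
      have "ac_eval x g ^ (CARD('a) ^ m) = ac_eval x g" for g
        using x ac_eval_frobenius[of x m g] by (simp add: R_def)
      hence "\<phi> \<in> X_points f m" unfolding X_points_eq by (simp add: ev) (simp add: \<phi>_def)
      moreover have "x = \<phi> (residue_class f [:0, 1:])" by (simp add: ev)
      ultimately show "x \<in> (\<lambda>\<phi>. \<phi> (residue_class f [:0, 1:])) ` X_points f m" by blast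
    qed
  qed
  thus ?thesis unfolding R_def by (rule bij_betw_same_card)
qed


subsection \<open>The zeta function\<close>

text \<open>The logarithmic derivative of 1 - T^d is minus the sum of d T^n over all n with d
  dividing n + 1, and logarithmic derivatives add over a product. The identity is stated multiplied
  out, so that no division of power series occurs.\<close>

lemma fps_deriv_prod_one_minus_X_power:
  fixes d :: "'b \<Rightarrow> nat"
  assumes "finite S" "\<And>s. s \<in> S \<Longrightarrow> d s > 0"
  shows "fps_deriv (\<Prod>s\<in>S. 1 - fps_X ^ d s) =
    - Abs_fps (\<lambda>n. of_nat (\<Sum>s\<in>S.
      if d s dvd Suc n then d s else 0)) * (\<Prod>s\<in>S. 1 - fps_X ^ d s :: rat fps)"
  using assms
proof (induction S rule: finite_induct)
  case empty
  have "Abs_fps (\<lambda>n. 0 :: rat) = 0" by (simp add: fps_eq_iff)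
  thus ?case by simp
next
  case (insert s S)
  define k where "k = d s"
  have k: "k > 0" using insert by (simp add: k_def)
  define B where "B = Abs_fps (\<lambda>n. if k dvd Suc n then of_nat k else (0::rat))"
  define C where "C = Abs_fps (\<lambda>n. of_nat (\<Sum>s\<in>S. if d s dvd Suc n then d s else 0) :: rat)"
  define F G where "F = (1 - fps_X ^ k :: rat fps)" and "G = (\<Prod>s\<in>S. 1 - fps_X ^ d s :: rat fps)"
  have F': "fps_deriv F = - B * F"
    unfolding F_def
  proof (rule fps_ext)
    fix n
    have dvd: "k dvd Suc (n - k) \<longleftrightarrow> k dvd Suc n" if "n \<ge> k"
      using that k by (metis Suc_diff_le dvd_minus_self le_SucI not_less)
    have "B * (1 - fps_X ^ k) = B - fps_X ^ k * B" by (simp add: algebra_simps)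
    hence "fps_nth (- B * (1 - fps_X ^ k)) n = - (if n < k \<and> k dvd Suc n then of_nat k else 0)"
      using dvd by (auto simp: fps_X_power_mult_nth B_def)
    \<comment> \<open>Multiplying the periodic series \<open>B\<close> by 1 - T^k leaves only its
      first period, whose single nonzero coefficient is at n = k - 1.\<close>
    also have "n < k \<and> k dvd Suc n \<longleftrightarrow> Suc n = k"
      using k by (auto dest: dvd_imp_le)
    finally show "fps_nth (fps_deriv (1 - fps_X ^ k)) n = fps_nth (- B * (1 - fps_X ^ k)) n"
      by (simp add: fps_X_power_nth)
  qed
  have G': "fps_deriv G = - C * G"
    unfolding C_def G_def using insert by blast
  have BC: "Abs_fps (\<lambda>n. of_nat (\<Sum>s\<in>insert s S. if d s dvd Suc n then d s else 0)) = B + C"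
    using insert by (simp add: fps_eq_iff B_def C_def k_def)
  have "fps_deriv (F * G) = - (B + C) * (F * G)"
    unfolding fps_deriv_mult F' G' by (simp add: algebra_simps)
  moreover have "(\<Prod>s\<in>insert s S. 1 - fps_X ^ d s) = F * G"
    using insert.hyps by (simp add: F_def G_def k_def)
  ultimately show ?case unfolding BC by simp
qed

definition zeta_denom :: "'a::{field,finite} poly \<Rightarrow> rat poly" where
  "zeta_denom f = (\<Prod>p\<in>prime_divs f. 1 - Polynomial.monom 1 (Polynomial.degree p))"

text \<open>With E = exp A one has E' = E A', while the logarithmic derivative of the denominator Q
  is -A', the coefficients of A' being exactly the point counts. Hence E Q has derivative 0 and
  equals its constant term 1.\<close>

lemma zeta_series_mult_denom:
  fixes f :: "'a::{field,finite} poly"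
  assumes "f \<noteq> 0"
  shows "zeta_series f * fps_of_poly (zeta_denom f) = 1"
proof -
  define c where "c m = (\<Sum>p\<in>prime_divs f. if Polynomial.degree p dvd m then Polynomial.degree p else 0)" for m
  have c: "card (X_points f m) = c m" for m
    unfolding card_X_points c_def using card_fixed_ac_roots[OF assms] .
  define A where "A = Abs_fps (\<lambda>m. if m = 0 then 0 else of_nat (c m) / of_nat m :: rat)"
  define E where "E = fps_exp 1 oo A"
  define Q :: "rat fps" where "Q = (\<Prod>p\<in>prime_divs f. 1 - fps_X ^ Polynomial.degree p)"
  have A': "fps_deriv A = Abs_fps (\<lambda>n. of_nat (c (Suc n)))"
    by (simp add: fps_eq_iff A_def del: of_nat_Suc)
  have pos: "Polynomial.degree p > 0" if "p \<in> prime_divs f" for p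
    using that monic_irreduciblesD(5) by (auto simp: prime_divs_def)
  have Q': "fps_deriv Q = - fps_deriv A * Q"
    unfolding A' Q_def c_def
      by (rule fps_deriv_prod_one_minus_X_power) (use finite_prime_divs[OF assms] pos in auto)
  have "fps_deriv E = E * fps_deriv A"
    unfolding E_def by (subst fps_compose_deriv) (simp_all add: A_def)
  hence "fps_deriv (E * Q) = 0" using Q' by (simp add: algebra_simps)
  hence "E * Q = fps_const ((E * Q) $ 0)" by (simp only: fps_deriv_eq_0_iff)
  also have "(E * Q) $ 0 = Q $ 0" by (simp add: E_def)
  also have "Q $ 0 = 1" unfolding Q_def using finite_prime_divs[OF assms] pos
    by (induction rule: finite_induct) auto
  finally have "E * Q = 1" by simp
  moreover have "fps_of_poly (zeta_denom f) = Q"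
    by (simp add: zeta_denom_def Q_def fps_of_poly_prod fps_of_poly_diff fps_of_poly_monom')
  moreover have "zeta_series f = E" unfolding zeta_series_def E_def A_def c ..
  ultimately show ?thesis by simp
qed

text \<open>The zero at 1 is simple because the derivative there is -d, which is nonzero in
  characteristic 0.\<close>

lemma order_1_one_minus_monom:
  assumes "d > 0"
  shows "Polynomial.order 1 (1 - Polynomial.monom 1 d :: rat poly) = 1"
proof -
  let ?P = "1 - Polynomial.monom 1 d :: rat poly"
  have nz: "?P \<noteq> 0"
  proof
    assume "?P = 0"
    hence "Polynomial.coeff ?P d = Polynomial.coeff 0 d" by (rule arg_cong)
    thus False using assms by simp
  qed
  have "poly (pderiv ?P) 1 \<noteq> 0" using assms by (simp add: pderiv_diff pderiv_monom poly_monom)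
  hence "Polynomial.order 1 (pderiv ?P) = 0" "pderiv ?P \<noteq> 0" by (auto simp: order_0I)
  moreover have "Polynomial.order 1 ?P > 0" using nz by (simp add: order_gt_0_iff poly_monom)
  ultimately show ?thesis using order_pderiv[of ?P 1] nz by (simp add: poly_monom)
qed

lemma order_zeta_denom:
  assumes "f \<noteq> 0"
  shows "zeta_denom f \<noteq> 0" "Polynomial.order 1 (zeta_denom f) = card (prime_divs f)"
proof -
  have "prime_divs f \<subseteq> monic_irreducibles" by (auto simp: prime_divs_def)
  with finite_prime_divs[OF assms]
  have "zeta_denom f \<noteq> 0 \<and> Polynomial.order 1 (zeta_denom f) = card (prime_divs f)"
    unfolding zeta_denom_def
  proof (induction rule: finite_induct)
    case (insert p S)
    let ?P = "1 - Polynomial.monom 1 (Polynomial.degree p) :: rat poly"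
    have "Polynomial.order 1 ?P = 1"
      using insert.prems monic_irreduciblesD(5) by (intro order_1_one_minus_monom) auto
    moreover have "Polynomial.coeff ?P (Polynomial.degree p) \<noteq> Polynomial.coeff 0 (Polynomial.degree p)"
      using insert.prems monic_irreduciblesD(5)[of p] by simp
    hence "?P \<noteq> 0" by (rule contrapos_nn) (rule arg_cong)
    ultimately show ?case using insert by (simp add: order_mult)
  qed auto
  thus "zeta_denom f \<noteq> 0" "Polynomial.order 1 (zeta_denom f) = card (prime_divs f)" by auto
qed

text \<open>The fraction 1/Q is already reduced, but \<open>quot_of_fract\<close> may rescale it.
  Its numerator divides its denominator and is coprime to it, hence is a nonzero constant, and the
  order of the zero at 1 is that of Q.\<close>

lemma r_eq_card_prime_divs:
  fixes f :: "'a::{field,finite} poly"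
  assumes "f \<noteq> 0"
  shows "r f = card (prime_divs f)"
proof -
  define Q where "Q = zeta_denom f"
  have Q: "Q \<noteq> 0" "Polynomial.order 1 Q = card (prime_divs f)"
    using order_zeta_denom[OF assms] by (auto simp: Q_def)
  have zeta: "zeta f = Fraction_Field.Fract 1 Q"
    unfolding Q_def by (rule zeta_eqI) (use order_zeta_denom zeta_series_mult_denom assms in auto)
  define a b where "a = fst (quot_of_fract (zeta f))" and "b = snd (quot_of_fract (zeta f))"
  have b: "b \<noteq> 0" by (simp add: b_def)
  have "Fraction_Field.Fract a b = Fraction_Field.Fract 1 Q" by (simp add: a_def b_def zeta)
  hence ab: "a * Q = b" using b Q by (simp add: eq_fract)
  moreover have "coprime a b" unfolding a_def b_def by (rule coprime_quot_of_fract)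
  ultimately have "is_unit a" by (metis coprime_common_divisor dvd_refl dvd_triv_left)
  then obtain c where "a = [:c:]" "c \<noteq> 0" by (metis is_unit_polyE' monom_0)
  hence "Polynomial.order 1 b = Polynomial.order 1 Q"
    using ab by (simp add: order_smult flip: ab)
  thus ?thesis using Q by (simp add: r_def pole_order_def b_def)
qed


subsection \<open>Euler products over finite sets of primes\<close>

definition monics :: "'a::{field,finite} poly set" where
  "monics = {f. Polynomial.lead_coeff f = 1}"

text \<open>By unique factorization these are the terms that appear when the Euler product over
  \<open>S\<close> is expanded.\<close>

definition smooth :: "'a::{field,finite} poly set \<Rightarrow> 'a poly set" where
  "smooth S = {f \<in> monics. prime_divs f \<subseteq> S}"

definition euler_weight :: "complex \<Rightarrow> real \<Rightarrow> 'a::{field,finite} poly \<Rightarrow> complex" where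
  "euler_weight z T f = z ^ card (prime_divs f) * of_real T ^ Polynomial.degree f"

text \<open>Closed form of 1 + z t + z t^2 + ... with t = T^(deg p): the weight z records whether p
  divides a polynomial, not how often.\<close>

abbreviation euler_factor :: "complex \<Rightarrow> real \<Rightarrow> 'a::{field,finite} poly \<Rightarrow> complex" where
  "euler_factor z T p \<equiv> 1 + z * of_real T ^ Polynomial.degree p / (1 - of_real T ^ Polynomial.degree p)"

lemma monics_nonzero: "f \<in> monics \<Longrightarrow> f \<noteq> 0"
  by (auto simp: monics_def)

lemma monic_irreducibles_subset_monics: "monic_irreducibles \<subseteq> monics"
  by (auto simp: monic_irreducibles_def monics_def)

lemma monics_mult_iff: "f \<in> monics \<Longrightarrow> f * g \<in> monics \<longleftrightarrow> g \<in> monics"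
  by (simp add: monics_def lead_coeff_mult)

lemma monics_power: "f \<in> monics \<Longrightarrow> f ^ k \<in> monics"
  by (simp add: monics_def lead_coeff_power)

lemma prime_divs_power_mult:
  assumes p: "p \<in> monic_irreducibles"
  shows "prime_divs (p ^ k * f) = (if k = 0 then prime_divs f else insert p (prime_divs f))"
proof (cases "k = 0")
  case False
  have "p' dvd p ^ k * f \<longleftrightarrow> p' = p \<or> p' dvd f" if p': "p' \<in> monic_irreducibles" for p'
  proof
    assume "p' dvd p ^ k * f"
    hence "p' dvd p ^ k \<or> p' dvd f"
      using prime_elem_dvd_multD[OF monic_irreduciblesD(3)[OF p']] by blast
    thus "p' = p \<or> p' dvd f"
      using prime_elem_dvd_power[OF monic_irreduciblesD(3)[OF p']]
        monic_irreducibles_dvd_imp_eq[OF p' p] by blast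
  next
    assume "p' = p \<or> p' dvd f"
    thus "p' dvd p ^ k * f"
    proof
      assume "p' = p"
      thus ?thesis using False by (auto intro: dvd_mult2)
    qed auto
  qed
  thus ?thesis using False p by (auto simp: prime_divs_def)
qed simp

lemma ex_power_mult_not_dvd:
  fixes g :: "'a::{field,finite} poly"
  assumes p: "p \<in> monic_irreducibles" and g: "g \<noteq> 0"
  shows "\<exists>k f. g = p ^ k * f \<and> \<not> p dvd f"
  using g
proof (induction "Polynomial.degree g" arbitrary: g rule: less_induct)
  case less
  show ?case
  proof (cases "p dvd g")
    case True
    then obtain h where h: "g = p * h" by (rule dvdE)
    with less.prems have "h \<noteq> 0" "p \<noteq> 0" by auto
    hence "Polynomial.degree h < Polynomial.degree g"
      using h monic_irreduciblesD(5)[OF p] by (simp add: degree_mult_eq)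
    then obtain k f where "h = p ^ k * f" "\<not> p dvd f" using less.hyps \<open>h \<noteq> 0\<close> by blast
    hence "g = p ^ Suc k * f" using h by (simp add: mult_ac)
    thus ?thesis using \<open>\<not> p dvd f\<close> by blast
  next
    case False
    hence "g = p ^ 0 * g \<and> \<not> p dvd g" by simp
    thus ?thesis by blast
  qed
qed

text \<open>Unique factorization, one prime at a time: the full power of \<open>p\<close> is split
  off. The exponent is unique because the remaining cofactor is not divisible by
  \<open>p\<close>.\<close>

lemma smooth_insert_bij_betw:
  fixes p :: "'a::{field,finite} poly"
  assumes p: "p \<in> monic_irreducibles" "p \<notin> S"
  shows "bij_betw (\<lambda>(k, f). p ^ k * f) (UNIV \<times> smooth S) (smooth (insert p S))"
proof -
  have ndvd: "\<not> p dvd f" if "f \<in> smooth S" for f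
    using that p by (auto simp: smooth_def prime_divs_def)
  have aux: False if "k < l" "p ^ k * f = p ^ l * g" "f \<in> smooth S" for k l f g
  proof -
    have "p ^ l = p ^ k * (p * p ^ (l - Suc k))"
      using that(1) by (simp flip: power_Suc power_add)
    with that(2) have "p ^ k * f = p ^ k * (p * p ^ (l - Suc k) * g)" by (simp add: mult_ac)
    hence "f = p * (p ^ (l - Suc k) * g)"
      using monic_irreduciblesD(4)[OF p(1)] by (simp add: mult.assoc)
    thus False using ndvd[OF that(3)] by simp
  qed
  have pm: "p ^ k \<in> monics" for k
    using p monic_irreducibles_subset_monics monics_power by blast
  show ?thesis
    unfolding bij_betw_def
  proof
    show "inj_on (\<lambda>(k, f). p ^ k * f) (UNIV \<times> smooth S)"
    proof (rule inj_onI)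
      fix x y assume xy: "x \<in> UNIV \<times> smooth S" "y \<in> UNIV \<times> smooth S"
        "(case x of (k, f) \<Rightarrow> p ^ k * f) = (case y of (k, f) \<Rightarrow> p ^ k * f)"
      obtain k f where x: "x = (k, f)" by (cases x)
      obtain l g where y: "y = (l, g)" by (cases y)
      have "k = l"
        using aux[of k l f g] aux[of l k g f] xy x y by (cases k l rule: linorder_cases) auto
      thus "x = y" using xy x y monic_irreduciblesD(4)[OF p(1)] by simp
    qed
    show "(\<lambda>(k, f). p ^ k * f) ` (UNIV \<times> smooth S) = smooth (insert p S)"
    proof (intro equalityI subsetI)
      fix g assume "g \<in> (\<lambda>(k, f). p ^ k * f) ` (UNIV \<times> smooth S)"
      then obtain k f where "g = p ^ k * f" "f \<in> smooth S" by auto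
      thus "g \<in> smooth (insert p S)"
        using prime_divs_power_mult[OF p(1), of k f] monics_mult_iff[OF pm, of k f]
          by (auto simp: smooth_def)
    next
      fix g assume g: "g \<in> smooth (insert p S)"
      then obtain k f where kf: "g = p ^ k * f" "\<not> p dvd f"
        using ex_power_mult_not_dvd[OF p(1), of g] monics_nonzero by (auto simp: smooth_def)
      have "p \<notin> prime_divs f" "prime_divs f \<subseteq> prime_divs g"
        using kf prime_divs_power_mult[OF p(1), of k f] by (auto simp: prime_divs_def)
      moreover have "f \<in> monics" using g kf monics_mult_iff[OF pm, of k f] by (simp add: smooth_def)
      ultimately have "f \<in> smooth S" using g by (auto simp: smooth_def)
      thus "g \<in> (\<lambda>(k, f). p ^ k * f) ` (UNIV \<times> smooth S)" using kf by auto
    qed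
  qed
qed

lemma smooth_empty: "smooth ({} :: 'a::{field,finite} poly set) = {1}"
proof (intro equalityI subsetI)
  fix f assume f: "f \<in> smooth ({} :: 'a poly set)"
  hence "\<not> Polynomial.degree f > 0"
    using ex_monic_irreducible_dvd[of f] by (auto simp: smooth_def prime_divs_def)
  hence "Polynomial.degree f = 0" by simp
  then obtain c where "f = [:c:]" by (rule degree_eq_zeroE)
  thus "f \<in> {1}" using f by (simp add: smooth_def monics_def one_pCons)
next
  fix f :: "'a poly" assume "f \<in> {1}"
  thus "f \<in> smooth {}"
    using monic_irreduciblesD(6) by (auto simp: smooth_def monics_def prime_divs_def)
qed

lemma euler_weight_power_mult:
  assumes p: "p \<in> monic_irreducibles" and f: "\<not> p dvd f" "f \<noteq> 0"
  shows "euler_weight z T (p ^ k * f) =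
    (if k = 0 then 1 else z) * (of_real T ^ Polynomial.degree p) ^ k * euler_weight z T f"
proof -
  have nz: "p ^ k \<noteq> 0" using monic_irreduciblesD(4)[OF p] by simp
  have "card (insert p (prime_divs f)) = Suc (card (prime_divs f))"
    using f finite_prime_divs[OF f(2)] by (simp add: prime_divs_def)
  thus ?thesis using f nz
    by (simp add: euler_weight_def prime_divs_power_mult[OF p] degree_mult_eq degree_power_eq monic_irreduciblesD(4)[OF p]
        power_add mult.commute[of k] flip: power_mult)
qed

section \<open>Unordered sums and Euler products evaluated by degree\<close>

definition monics_upto :: "nat \<Rightarrow> 'a::{field,finite} poly set" where
  "monics_upto D = (\<Union>d\<le>D. monic_polys d)"

lemma finite_monics_upto: "finite (monics_upto D :: 'a::{field,finite} poly set)"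
  unfolding monics_upto_def by (intro finite_UN_I finite_monic_polys) auto

lemma monics_upto_iff: "f \<in> monics_upto D \<longleftrightarrow> f \<in> monics \<and> Polynomial.degree f \<le> D"
  by (auto simp: monics_upto_def monics_def monic_polys_def)

lemma sum_monics_upto:
  "sum F (monics_upto D :: 'a::{field,finite} poly set) = (\<Sum>d\<le>D. \<Sum>f\<in>monic_polys d. F f)"
  unfolding monics_upto_def
  by (rule sum.UNION_disjoint) (auto simp: finite_monic_polys, auto simp: monic_polys_def)

text \<open>A finite set of polynomials has bounded degree, so the truncations by degree are
  eventually above it. This converts limits along the net of finite subsets into limits of
  sequences.\<close>

lemma filterlim_finite_subsets_bounded_degree:
  fixes A :: "'a::{field,finite} poly set"
  assumes "A \<subseteq> monics"
  shows "filterlim (\<lambda>D. A \<inter> monics_upto D) (finite_subsets_at_top A) sequentially"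
  unfolding filterlim_finite_subsets_at_top
proof (intro allI impI)
  fix Y assume Y: "finite Y \<and> Y \<subseteq> A"
  define N where "N = Max (insert 0 (Polynomial.degree ` Y))"
  show "\<forall>\<^sub>F D in sequentially. finite (A \<inter> monics_upto D) \<and> Y \<subseteq> A \<inter> monics_upto D
      \<and> A \<inter> monics_upto D \<subseteq> A"
    using eventually_ge_at_top[of N]
  proof eventually_elim
    case (elim D)
    have "Polynomial.degree f \<le> D" if "f \<in> Y" for f
    proof -
      have "Polynomial.degree f \<le> N" unfolding N_def using Y that by (intro Max_ge) auto
      thus ?thesis using elim by simp
    qed
    thus ?case using Y assms finite_monics_upto by (auto simp: monics_upto_iff)
  qed
qed

context
  fixes q :: nat and T :: real
  assumes q: "q = CARD('a::{field,finite})" and T: "0 \<le> T" "real q * T < 1"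
begin

lemma T_less_1: "T < 1"
proof (rule ccontr)
  assume "\<not> T < 1"
  hence "1 * 1 \<le> real q * T" using card_field_ge_2[where 'a = 'a] q by (intro mult_mono) auto
  thus False using T by simp
qed

lemma sum_degree_power_monics_upto:
  "(\<Sum>f\<in>(monics_upto D :: 'a poly set). T ^ Polynomial.degree f) = (\<Sum>d\<le>D. (real q * T) ^ d)"
proof -
  have "(\<Sum>f\<in>(monic_polys d :: 'a poly set). T ^ Polynomial.degree f)
      = (\<Sum>f\<in>(monic_polys d :: 'a poly set). T ^ d)" for d
    by (intro sum.cong) (auto simp: monic_polys_def)
  thus ?thesis unfolding sum_monics_upto by (simp add: card_monic_polys q power_mult_distrib)
qed

text \<open>The zeta function of the affine line. Terms are nonnegative, so bounding finite sums by
  truncations gives unordered summability, and the value is then read off along the truncations.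
  This sum is the majorant for all later sums over monic polynomials or primes.\<close>

lemma has_sum_degree_power_monics:
  "((\<lambda>f. T ^ Polynomial.degree f) has_sum (1 / (1 - real q * T))) (monics :: 'a poly set)"
proof -
  have geo: "(\<lambda>D. \<Sum>d\<le>D. (real q * T) ^ d) \<longlonglongrightarrow> 1 / (1 - real q * T)"
    using geometric_sums[of "real q * T"] T by (simp add: sums_def_le)
  have "(\<lambda>f. T ^ Polynomial.degree f) summable_on (monics :: 'a poly set)"
  proof (rule nonneg_bounded_partial_sums_imp_summable_on)
    show "\<forall>\<^sub>F Y in finite_subsets_at_top (monics :: 'a poly set). (\<Sum>f\<in>Y. T ^ Polynomial.degree f)
        \<le> 1 / (1 - real q * T)"
      unfolding eventually_finite_subsets_at_top
    proof (intro exI[of _ "{}"] conjI allI impI)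
      fix Y :: "'a poly set" assume Y: "finite Y \<and> {} \<subseteq> Y \<and> Y \<subseteq> monics"
      define D where "D = Max (insert 0 (Polynomial.degree ` Y))"
      have "Y \<subseteq> monics_upto D" using Y by (auto simp: monics_upto_iff D_def intro!: Max_ge)
      hence "(\<Sum>f\<in>Y. T ^ Polynomial.degree f)
          \<le> (\<Sum>f\<in>(monics_upto D :: 'a poly set). T ^ Polynomial.degree f)"
        using T by (intro sum_mono2 finite_monics_upto) auto
      also have "\<dots> = (\<Sum>d\<le>D. (real q * T) ^ d)" by (rule sum_degree_power_monics_upto)
      also have "\<dots> \<le> (\<Sum>d. (real q * T) ^ d)"
        using T by (intro sum_le_suminf summable_geometric) auto
      also have "\<dots> = 1 / (1 - real q * T)" using T by (intro suminf_geometric) auto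
      finally show "(\<Sum>f\<in>Y. T ^ Polynomial.degree f) \<le> 1 / (1 - real q * T)" .
    qed auto
  qed (use T in auto)
  then obtain s where s: "((\<lambda>f. T ^ Polynomial.degree f) has_sum s) (monics :: 'a poly set)"
    by (auto simp: summable_on_def)
  have "(\<lambda>D. \<Sum>f\<in>(monics \<inter> monics_upto D :: 'a poly set). T ^ Polynomial.degree f) \<longlonglongrightarrow> s"
    using s unfolding has_sum_def
    by (rule filterlim_compose) (intro filterlim_finite_subsets_bounded_degree order_refl)
  moreover have "monics \<inter> monics_upto D = (monics_upto D :: 'a poly set)"
    for D by (auto simp: monics_upto_iff)
  ultimately have "s = 1 / (1 - real q * T)"
    using LIMSEQ_unique[OF geo] by (simp add: sum_degree_power_monics_upto)
  thus ?thesis using s by simp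
qed

context
  fixes z :: complex
  assumes z: "norm z \<le> 1"
begin

lemma norm_euler_weight_le: "norm (euler_weight z T f) \<le> T ^ Polynomial.degree f"
  using T z by (simp add: euler_weight_def norm_mult norm_power mult_left_le_one_le power_le_one)

lemma euler_weight_abs_summable: "(\<lambda>f. norm (euler_weight z T f)) summable_on (monics :: 'a poly set)"
  by (rule summable_on_comparison_test[OF has_sum_imp_summable[OF has_sum_degree_power_monics]])
     (auto simp: norm_euler_weight_le)

lemma euler_weight_summable: 
  "A \<subseteq> (monics :: 'a poly set) \<Longrightarrow> euler_weight z T summable_on A"
  using summable_on_subset_banach abs_summable_summable[OF euler_weight_abs_summable] by blast

lemma has_sum_local_factor:
  assumes "d > 0"
  shows "((\<lambda>k. (if k = 0 then 1 else z) * (of_real T ^ d) ^ k)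
      has_sum (1 + z * of_real T ^ d / (1 - of_real T ^ d))) UNIV"
proof (rule norm_summable_imp_has_sum)
  define t where "t = (of_real T ^ d :: complex)"
  have "T ^ d < 1" using T T_less_1 assms by (simp add: power_less_one_iff)
  hence t: "norm t < 1" using T by (simp add: t_def norm_power)
  have "summable (\<lambda>k. norm t ^ k)" using t by (intro summable_geometric) auto
  thus "summable (\<lambda>k. norm ((if k = 0 then 1 else z) * (of_real T ^ d) ^ k))"
    unfolding t_def[symmetric]
    by (rule summable_comparison_test'[where N = 0]) (use z in \<open>auto simp: norm_mult norm_power mult_left_le_one_le\<close>)
  have "(\<lambda>k. z * t ^ k) sums (z * (1 / (1 - t)))" by (intro sums_mult geometric_sums t)
  \<comment> \<open>The geometric series times z has the term z at k = 0 where 1 is wanted; this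
    series corrects it.\<close>
  moreover have "(\<lambda>k. if k = 0 then 1 - z else 0) sums (1 - z)"
    using sums_single[of 0 "\<lambda>_. 1 - z"] by simp
  ultimately have "(\<lambda>k. z * t ^ k + (if k
      = 0 then 1 - z else 0)) sums (z * (1 / (1 - t)) + (1 - z))"
    by (rule sums_add)
  also have "(\<lambda>k. z * t ^ k + (if k = 0 then 1 - z else 0)) = (\<lambda>k. (if k
      = 0 then 1 else z) * t ^ k)"
    by auto
  also have "z * (1 / (1 - t)) + (1 - z) = 1 + z * t / (1 - t)"
  proof -
    have "1 - t \<noteq> 0" using t by auto
    thus ?thesis by (simp add: field_simps)
  qed
  finally
    show "(\<lambda>k. (if k = 0 then 1 else z) * (of_real T ^ d) ^ k) sums (1 + z * of_real T ^ d / (1 - of_real T ^ d))"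
    by (simp add: t_def)
qed

text \<open>Adding a prime turns the sum into a double sum over the exponent of \<open>p\<close> and
  the part prime to \<open>p\<close>. The weight factors accordingly, and absolute summability
  allows iterated summation.\<close>

lemma has_sum_euler_weight_smooth:
  assumes "finite S" "S \<subseteq> (monic_irreducibles :: 'a poly set)"
  shows "(euler_weight z T has_sum
    (\<Prod>p\<in>S. euler_factor z T p)) (smooth S)"
  using assms
proof (induction S rule: finite_induct)
  case empty
  have "prime_divs (1 :: 'a poly) = {}" using monic_irreduciblesD(6) by (auto simp: prime_divs_def)
  hence "(\<Sum>f\<in>{1 :: 'a poly}. euler_weight z T f) = 1" by (simp add: euler_weight_def)
  thus ?case using has_sum_finite[of "{1 :: 'a poly}" "euler_weight z T"]
    by (simp only: smooth_empty prod.empty finite.intros)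
next
  case (insert p S)
  define P where "P = (\<Prod>p\<in>S. euler_factor z T p)"
  define c where "c k = (if k = 0 then 1 else z) * (of_real T ^ Polynomial.degree p) ^ k"
    for k :: nat
  have p: "p \<in> monic_irreducibles" using insert by simp
  have bij: "bij_betw (\<lambda>(k, f). p ^ k * f) (UNIV \<times> smooth S) (smooth (insert p S))"
    by (rule smooth_insert_bij_betw) (use insert in auto)
  define W where "W = (\<lambda>x. euler_weight z T ((\<lambda>(k, f). p ^ k * f) x))"
  have W: "W (k, f) = c k * euler_weight z T f" if "f \<in> smooth S" for k f
  proof -
    have "\<not> p dvd f" "f \<noteq> 0"
      using that insert.hyps p monics_nonzero[of f] by (auto simp: smooth_def prime_divs_def)
    thus ?thesis by (simp add: W_def c_def euler_weight_power_mult[OF p])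
  qed
  have "(W has_sum (euler_factor z T p * P)) (UNIV \<times> smooth S)"
  proof (rule has_sum_SigmaI)
    fix k :: nat
    have "((\<lambda>f. c k * euler_weight z T f) has_sum (c k * P)) (smooth S)"
      unfolding P_def by (intro has_sum_cmult_right) (use insert in auto)
    thus "((\<lambda>f. W (k, f)) has_sum (c k * P)) (smooth S)"
      by (rule has_sum_cong[THEN iffD1, rotated]) (simp add: W)
  next
    show "((\<lambda>k. c k * P) has_sum (euler_factor z T p * P)) UNIV"
      unfolding c_def by (intro has_sum_cmult_left has_sum_local_factor monic_irreduciblesD(5) p)
  next
    have "euler_weight z T summable_on smooth (insert p S)"
      by (rule euler_weight_summable) (auto simp: smooth_def)
    thus "W summable_on UNIV \<times> smooth S"
      unfolding W_def using summable_on_reindex_bij_betw[OF bij, of "euler_weight z T"] by blast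
  qed
  hence "(euler_weight z T has_sum (euler_factor z T p * P)) (smooth (insert p S))"
    unfolding W_def using has_sum_reindex_bij_betw[OF bij, of "euler_weight z T"] by blast
  thus ?case using insert.hyps by (simp add: P_def)
qed

text \<open>A monic polynomial missed by the product over primes of degree at most D has a prime
  divisor of larger degree, so its own degree exceeds D. The error is therefore at most the tail of
  the convergent sum of T^(deg f).\<close>

lemma euler_product_limit:
  "(\<lambda>D. \<Prod>p\<in>(monic_irreducibles \<inter> monics_upto D :: 'a poly set).
      euler_factor z T p)
     \<longlonglongrightarrow> infsum (euler_weight z T) (monics :: 'a poly set)"
proof -
  define P where "P D = (monic_irreducibles \<inter> monics_upto D :: 'a poly set)" for D
  define g where "g f = T ^ Polynomial.degree f" for f :: "'a poly"
  define G where "G = infsum g (monics :: 'a poly set)"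
  have g: "g summable_on A" if "A \<subseteq> monics" for A
    using summable_on_subset_banach[OF has_sum_imp_summable[OF has_sum_degree_power_monics] that]
    unfolding g_def .
  define F where "F = infsum (euler_weight z T) (monics :: 'a poly set)"
  have bound: "norm (F - (\<Prod>p\<in>P D. euler_factor z T p)) \<le> G - sum g (monics_upto D)" for D
  proof -
    have finP: "finite (P D)" unfolding P_def by (intro finite_Int disjI2 finite_monics_upto)
    have sub: "smooth (P D) \<subseteq> monics" by (auto simp: smooth_def)
    have 1: "(euler_weight z T has_sum (F - (\<Prod>p\<in>P D. euler_factor z T p))) (monics - smooth (P D))"
    proof (rule has_sum_Diff[OF _ _ sub])
      show "(euler_weight z T has_sum F) (monics :: 'a poly set)"
        unfolding F_def by (intro has_sum_infsum euler_weight_summable order_refl)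
    qed (rule has_sum_euler_weight_smooth[OF finP], simp add: P_def)
    have 2: "(g has_sum infsum g (monics - smooth (P D))) (monics - smooth (P D))"
      by (intro has_sum_infsum g) auto
    have "norm (F - (\<Prod>p\<in>P D. euler_factor z T p)) \<le> infsum g (monics - smooth (P D))"
      by (rule norm_infsum_le[OF 1 2]) (simp add: g_def norm_euler_weight_le)
    also have "\<dots> \<le> infsum g (monics - monics_upto D)"
    proof (rule infsum_mono2)
      show "monics - smooth (P D) \<subseteq> monics - monics_upto D"
      proof -
        have "f \<in> smooth (P D)" if "f \<in> monics_upto D" for f
          using that monic_irreducibles_subset_monics dvd_imp_degree_le[OF _ monics_nonzero]
          by (force simp: smooth_def P_def monics_upto_iff prime_divs_def)
        thus ?thesis by blast
      qed
    qed (use T in \<open>auto intro!: g simp: g_def\<close>)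
    also have "\<dots> = G - sum g (monics_upto D)"
    proof (rule infsumI)
      show "(g has_sum (G - sum g (monics_upto D))) (monics - monics_upto D)"
        unfolding G_def
          by (intro has_sum_Diff has_sum_infsum g has_sum_finite finite_monics_upto) (auto simp: monics_upto_iff)
    qed
    finally show ?thesis .
  qed
  have "(\<lambda>D. \<Sum>f\<in>(monics \<inter> monics_upto D :: 'a poly set). g f) \<longlonglongrightarrow> G"
    using has_sum_infsum[OF g[OF order_refl]] unfolding has_sum_def G_def
    by (rule filterlim_compose) (intro filterlim_finite_subsets_bounded_degree order_refl)
  moreover have "monics \<inter> monics_upto D = (monics_upto D :: 'a poly set)"
    for D by (auto simp: monics_upto_iff)
  ultimately have "(\<lambda>D. G - sum g (monics_upto D)) \<longlonglongrightarrow> G - G" by (intro tendsto_diff) auto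
  hence "(\<lambda>D. G - sum g (monics_upto D)) \<longlonglongrightarrow> 0" by simp
  hence "(\<lambda>D. F - (\<Prod>p\<in>P D. euler_factor z T p)) \<longlonglongrightarrow> 0"
    by (rule Lim_null_comparison[rotated]) (simp add: bound)
  from tendsto_diff[OF tendsto_const[of F] this] show ?thesis by (simp add: F_def P_def)
qed

lemma euler_weight_sums:
  "(\<lambda>d. (\<Sum>f\<in>(monic_polys d :: 'a poly set). z ^ card (prime_divs f)) * of_real T ^ d)
     sums infsum (euler_weight z T) (monics :: 'a poly set)"
proof -
  have "(\<lambda>D. \<Sum>f\<in>(monics \<inter> monics_upto D :: 'a poly set). euler_weight z T f)
      \<longlonglongrightarrow> infsum (euler_weight z T) (monics :: 'a poly set)"
    using has_sum_infsum[OF euler_weight_summable[OF order_refl]] unfolding has_sum_def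
    by (rule filterlim_compose) (intro filterlim_finite_subsets_bounded_degree order_refl)
  moreover have "monics \<inter> monics_upto D = (monics_upto D :: 'a poly set)"
    for D by (auto simp: monics_upto_iff)
  moreover have "(\<Sum>f\<in>(monic_polys d :: 'a poly set). euler_weight z T f) =
      (\<Sum>f\<in>(monic_polys d :: 'a poly set). z ^ card (prime_divs f)) * of_real T ^ d" for d
    unfolding sum_distrib_right by (intro sum.cong) (auto simp: monic_polys_def euler_weight_def)
  ultimately show ?thesis by (simp add: sums_def_le sum_monics_upto)
qed

end

end


subsection \<open>Uniform convergence of unordered products\<close>

text \<open>Induction on f P - 1 = (f - 1) P + (P - 1), with 1 + M <= exp M.\<close>

lemma norm_prod_minus_1_le:
  fixes f :: "'i \<Rightarrow> complex"
  assumes "finite S" "\<And>i. i \<in> S \<Longrightarrow> norm (f i - 1) \<le> M i"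
  shows "norm (prod f S - 1) \<le> exp (sum M S) - 1"
  using assms
proof (induction S rule: finite_induct)
  case (insert i S)
  define P where "P = prod f S"
  have IH: "norm (P - 1) \<le> exp (sum M S) - 1" using insert by (simp add: P_def)
  have "norm P \<le> norm (P - 1) + 1" using norm_triangle_ineq[of "P - 1" 1] by simp
  hence P: "norm P \<le> exp (sum M S)" using IH by simp
  have "norm (f i * P - 1) = norm ((f i - 1) * P + (P - 1))" by (simp add: algebra_simps)
  also have "\<dots> \<le> norm (f i - 1) * norm P + norm (P - 1)"
    by (metis norm_mult norm_triangle_ineq)
  also have "\<dots> \<le> M i * exp (sum M S) + (exp (sum M S) - 1)"
    using insert.prems P IH by (intro add_mono mult_mono) (auto intro: order_trans[OF norm_ge_zero])
  also have "\<dots> = (1 + M i) * exp (sum M S) - 1" by (simp add: algebra_simps)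
  also have "\<dots> \<le> exp (M i) * exp (sum M S) - 1"
    by (intro diff_right_mono mult_right_mono exp_ge_add_one_self) auto
  finally show ?case using insert.hyps by (simp add: P_def exp_add)
qed simp

text \<open>The cofinal sequence \<open>P\<close> produces the limit function through the uniform
  Cauchy criterion for sequences; the estimate \<open>close\<close>, which compares any product over
  a larger set with the one over \<open>S0\<close>, then carries the convergence over to the whole
  net.\<close>

lemma uniform_limit_prod_finite_subsets:
  fixes f :: "'i \<Rightarrow> 'b \<Rightarrow> complex"
  assumes bound: "\<And>i x. i \<in> A \<Longrightarrow> x \<in> B \<Longrightarrow> norm (f i x - 1) \<le> M i"
    and M: "M summable_on A" "\<And>i. i \<in> A \<Longrightarrow> 0 \<le> M i"
    and P: "filterlim P (finite_subsets_at_top A) sequentially"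
  obtains h where "uniform_limit B (\<lambda>S x. \<Prod>i\<in>S. f i x) h (finite_subsets_at_top A)"
proof -
  define m where "m = infsum M A"
  have sum_le: "sum M S \<le> m" if "finite S" "S \<subseteq> A" for S
    unfolding m_def using that M by (intro finite_sum_le_infsum) auto
  \<comment> \<open>The product over \<open>S0\<close> is bounded by exp m, and the product over
    \<open>S - S0\<close> differs from 1 by at most exp of the remaining mass, minus 1.\<close>
  have close: "dist (\<Prod>i\<in>S. f i x) (\<Prod>i\<in>S0. f i x) \<le> exp m * (exp (m - sum M S0) - 1)"
    if S: "finite S" "S0 \<subseteq> S" "S \<subseteq> A" and x: "x \<in> B" for S S0 x
  proof -
    have fin0: "finite S0" using S finite_subset by blast
    have split: "(\<Prod>i\<in>S. f i x) = (\<Prod>i\<in>S0. f i x) * (\<Prod>i\<in>S - S0. f i x)"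
      using S by (simp add: prod.subset_diff mult.commute)
    have "norm ((\<Prod>i\<in>S0. f i x) - 1) \<le> exp (sum M S0) - 1"
      using S x fin0 by (intro norm_prod_minus_1_le bound) auto
    hence "norm (\<Prod>i\<in>S0. f i x) \<le> exp (sum M S0)"
      using norm_triangle_ineq[of "(\<Prod>i\<in>S0. f i x) - 1" 1] by simp
    also have "\<dots> \<le> exp m" using sum_le[OF fin0] S by auto
    finally have 1: "norm (\<Prod>i\<in>S0. f i x) \<le> exp m" .
    have "norm ((\<Prod>i\<in>S - S0. f i x) - 1) \<le> exp (sum M (S - S0)) - 1"
      using S x by (intro norm_prod_minus_1_le bound) auto
    also have "sum M (S - S0) = sum M S - sum M S0" using S fin0 by (simp add: sum_diff)
    also have "exp (sum M S - sum M S0) - 1 \<le> exp (m - sum M S0) - 1"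
      using sum_le[OF S(1,3)] by simp
    finally have 2: "norm ((\<Prod>i\<in>S - S0. f i x) - 1) \<le> exp (m - sum M S0) - 1" .
    have "dist (\<Prod>i\<in>S. f i x) (\<Prod>i\<in>S0. f i x) = norm (\<Prod>i\<in>S0. f i x) * norm ((\<Prod>i\<in>S - S0. f i x) - 1)"
      unfolding split dist_norm norm_mult[symmetric] by (simp add: algebra_simps)
    also have "\<dots> \<le> exp m * (exp (m - sum M S0) - 1)"
      using 1 2 by (intro mult_mono) auto
    finally show ?thesis .
  qed
  have ex: "\<exists>S0. finite S0 \<and> S0 \<subseteq> A \<and> exp m * (exp (m - sum M S0) - 1) < e" if "e > 0" for e
  proof -
    have "(sum M \<longlongrightarrow> m) (finite_subsets_at_top A)"
      using has_sum_infsum[OF M(1)] by (simp add: has_sum_def m_def)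
    hence "((\<lambda>S0. exp m * (exp (m - sum M S0) - 1))
        \<longlongrightarrow> exp m * (exp (m - m) - 1)) (finite_subsets_at_top A)"
      by (intro tendsto_intros)
    hence "\<forall>\<^sub>F S0 in finite_subsets_at_top A. exp m * (exp (m - sum M S0) - 1) < e"
      using that by (intro order_tendstoD(2)) auto
    thus ?thesis unfolding eventually_finite_subsets_at_top by blast
  qed
  have evP: "\<forall>\<^sub>F n in sequentially. finite (P n) \<and> S0 \<subseteq> P n \<and> P n \<subseteq> A"
    if "finite S0" "S0 \<subseteq> A" for S0
    using P that unfolding filterlim_finite_subsets_at_top by blast
  have "uniformly_convergent_on B (\<lambda>n x. \<Prod>i\<in>P n. f i x)"
  proof (rule Cauchy_uniformly_convergent, unfold uniformly_Cauchy_on_def, intro allI impI)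
    fix e :: real assume "e > 0"
    then obtain S0 where S0: "finite S0" "S0 \<subseteq> A" "exp m * (exp (m - sum M S0) - 1) < e / 2"
      using ex[of "e / 2"] by auto
    obtain N where N: "\<And>n. n \<ge> N \<Longrightarrow> finite (P n) \<and> S0 \<subseteq> P n \<and> P n \<subseteq> A"
      using evP[OF S0(1,2)] unfolding eventually_sequentially by blast
    have "dist (\<Prod>i\<in>P k. f i x) (\<Prod>i\<in>P n. f i x) < e" if "x \<in> B" "k \<ge> N" "n \<ge> N" for x k n
      using close[of "P k" S0 x] close[of "P n" S0 x] N[of k] N[of n] that S0(3)
        dist_triangle2[of "\<Prod>i\<in>P k. f i x" "\<Prod>i\<in>P n. f i x" "\<Prod>i\<in>S0. f i x"] by auto
    thus "\<exists>N. \<forall>x\<in>B. \<forall>k\<ge>N. \<forall>n\<ge>N. dist (\<Prod>i\<in>P k. f i x) (\<Prod>i\<in>P n. f i x) < e" by blast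
  qed
  then obtain h where h: "uniform_limit B (\<lambda>n x. \<Prod>i\<in>P n. f i x) h sequentially"
    by (auto simp: uniformly_convergent_on_def)
  have "uniform_limit B (\<lambda>S x. \<Prod>i\<in>S. f i x) h (finite_subsets_at_top A)"
  proof (rule uniform_limitI)
    fix e :: real assume "e > 0"
    then obtain S0 where S0: "finite S0" "S0 \<subseteq> A" "exp m * (exp (m - sum M S0) - 1) < e / 3"
      using ex[of "e / 3"] by auto
    have "\<forall>\<^sub>F n in sequentially. \<forall>x\<in>B. dist (\<Prod>i\<in>P n. f i x) (h x) < e / 3"
      using uniform_limitD[OF h, of "e / 3"] \<open>e > 0\<close> by simp
    hence "\<forall>\<^sub>F n in sequentially. (finite (P n) \<and> S0 \<subseteq> P n \<and> P n \<subseteq> A)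
        \<and> (\<forall>x\<in>B. dist (\<Prod>i\<in>P n. f i x) (h x) < e / 3)"
      by (rule eventually_conj[OF evP[OF S0(1,2)]])
    then obtain n where n: "finite (P n)" "S0 \<subseteq> P n" "P n \<subseteq> A" "\<And>x. x \<in> B
        \<Longrightarrow> dist (\<Prod>i\<in>P n. f i x) (h x) < e / 3"
      using eventually_happens'[OF sequentially_bot] by blast
    have "dist (\<Prod>i\<in>S. f i x) (h x) < e" if S: "finite S" "S0 \<subseteq> S" "S \<subseteq> A" and x: "x \<in> B" for S x
      using close[OF S x] close[OF n(1-3) x] n(4)[OF x] S0(3)
        dist_triangle2[of "\<Prod>i\<in>S. f i x" "\<Prod>i\<in>P n. f i x" "\<Prod>i\<in>S0. f i x"]
        dist_triangle[of "\<Prod>i\<in>S. f i x" "h x" "\<Prod>i\<in>P n. f i x"] by linarith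
    thus "\<forall>\<^sub>F S in finite_subsets_at_top A. \<forall>x\<in>B. dist (\<Prod>i\<in>S. f i x) (h x) < e"
      unfolding eventually_finite_subsets_at_top using S0 by blast
  qed
  thus ?thesis by (rule that)
qed


subsection \<open>The local factor\<close>

text \<open>With t = T^(deg p) this is the Euler factor for z divided by the z-th power of the one
  for z = 1; the terms linear in t cancel.\<close>

definition local_factor :: "complex \<Rightarrow> complex \<Rightarrow> complex" where
  "local_factor z t = (1 - t) powr z * (1 + z * t / (1 - t))"

lemma one_minus_notin_nonpos_Reals:
  fixes t :: complex
  assumes "norm t < 1"
  shows "1 - t \<notin> \<real>\<^sub>\<le>\<^sub>0"
  using assms abs_Re_le_cmod[of t] by (auto simp: complex_nonpos_Reals_iff)

text \<open>The derivative is put in a form with an explicit factor t, the source of the quadratic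
  bound at 0.\<close>

lemma local_factor_has_field_derivative:
  assumes t: "norm t < 1"
  shows "(local_factor z has_field_derivative (- z * (z - 1) * t * (1 - t) powr (z - 2))) (at t)"
proof -
  have nz: "1 - t \<noteq> 0" and nn: "1 - t \<notin> \<real>\<^sub>\<le>\<^sub>0"
    using one_minus_notin_nonpos_Reals[OF t] by auto
  have 1: "(1 - t) powr z = (1 - t) powr (z - 2) * (1 - t) ^ 2"
    using nz by (simp add: powr_diff powr_numeral)
  have 2: "(1 - t) powr (z - 1) = (1 - t) powr (z - 2) * (1 - t)"
    using nz powr_add[of "1 - t" "z - 2" 1] by simp
  have "((\<lambda>t. (1 - t) powr z) has_field_derivative z * (1 - t) powr (z - 1) * (- 1)) (at t)"
    using nn by (auto intro!: derivative_eq_intros)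
  moreover have "((\<lambda>t. 1 + z * t / (1 - t)) has_field_derivative z / (1 - t) ^ 2) (at t)"
    by (rule derivative_eq_intros refl nz)+ (use nz in \<open>simp add: field_simps power2_eq_square\<close>)
  ultimately have "((\<lambda>t. (1 - t) powr z * (1 + z * t / (1 - t))) has_field_derivative
      (z * (1 - t) powr (z - 1) * (- 1)) * (1 + z * t / (1 - t)) +
      (1 - t) powr z * (z / (1 - t) ^ 2)) (at t)"
    by (rule DERIV_mult'[THEN DERIV_cong]) simp
  also have "(z * (1 - t) powr (z - 1) * (- 1)) * (1 + z * t / (1 - t)) + (1 - t) powr z * (z / (1 - t) ^ 2)
    = - z * (z - 1) * t * (1 - t) powr (z - 2)"
    unfolding 1 2 using nz by (simp add: divide_simps) (simp add: algebra_simps power2_eq_square)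
  finally show ?thesis unfolding local_factor_def[abs_def] .
qed

lemma local_factor_bound:
  assumes "0 < R" "R < 1"
  obtains C where "C \<ge> 0" "\<And>t. norm t \<le> R \<Longrightarrow> norm (local_factor z t - 1) \<le> C * norm t ^ 2"
proof -
  have "Re t < 1" if "t \<in> cball 0 R" for t :: complex
    using that assms complex_Re_le_cmod[of t] by auto
  hence "continuous_on (cball 0 R) (\<lambda>t. z * (z - 1) * (1 - t) powr (z - 2))"
    by (intro continuous_intros) (force, fastforce)
  hence "compact ((\<lambda>t. z * (z - 1) * (1 - t) powr (z - 2)) ` cball 0 R)"
    by (rule compact_continuous_image) auto
  hence "bounded ((\<lambda>t. z * (z - 1) * (1 - t) powr (z - 2)) ` cball 0 R)"
    by (rule compact_imp_bounded)
  then obtain C where C: "C > 0" "\<And>t. norm t \<le> R \<Longrightarrow> norm (z * (z - 1) * (1 - t) powr (z - 2)) \<le> C"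
    unfolding bounded_pos by auto
  show ?thesis
  proof (rule that[of C])
    fix t :: complex assume t: "norm t \<le> R"
    \<comment> \<open>The mean value bound is applied on the disc of radius |t| rather than R: the
      derivative is at most C |t| there, which supplies the second power of |t|.\<close>
    have "norm (local_factor z t - local_factor z 0) \<le> (C * norm t) * norm (t - 0)"
    proof (rule field_differentiable_bound)
      show "convex (cball (0::complex) (norm t))" by simp
      fix s :: complex assume s: "s \<in> cball 0 (norm t)"
      show "(local_factor z has_field_derivative (- z * (z - 1) * s * (1 - s) powr (z - 2))) (at s within cball 0 (norm t))"
        by (rule has_field_derivative_at_within, rule local_factor_has_field_derivative) (use s t assms in auto)
      have "norm (- z * (z - 1) * s * (1 - s) powr (z - 2))
          = norm (z * (z - 1) * (1 - s) powr (z - 2)) * norm s"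
        by (simp add: norm_mult)
      also have "\<dots> \<le> C * norm t" using C s t by (intro mult_mono) auto
      finally show "norm (- z * (z - 1) * s * (1 - s) powr (z - 2)) \<le> C * norm t" .
    qed auto
    thus "norm (local_factor z t - 1) \<le> C * norm t ^ 2"
      by (simp add: local_factor_def power2_eq_square mult_ac)
  qed (use C in auto)
qed


subsection \<open>Coefficient asymptotics\<close>

text \<open>The coefficients of (1 - T)^(-z) grow like n^(z-1)/Gamma(z). This is the limit formula
  for 1/Gamma, whose n-th term contains the further factor (z + n)/n, removed here.\<close>

lemma tendsto_pochhammer_over_fact:
  assumes z: "norm z \<le> 1"
  shows "(\<lambda>n. exp ((1 - z) * of_real (ln (real n))) * (pochhammer z n / fact n)) \<longlonglongrightarrow> rGamma z"
proof -
  have "(\<lambda>n. z * (1 / of_nat n) + 1) \<longlonglongrightarrow> z * 0 + 1"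
    by (intro tendsto_intros lim_1_over_n)
  hence "(\<lambda>n. inverse (z * (1 / of_nat n) + 1)) \<longlonglongrightarrow> inverse (z * 0 + 1)"
    by (rule tendsto_inverse) auto
  hence "(\<lambda>n. rGamma_series z n * inverse (z * (1 / of_nat n) + 1)) \<longlonglongrightarrow> rGamma z * 1"
    by (intro tendsto_mult rGamma_series_LIMSEQ) simp
  moreover have "\<forall>\<^sub>F n in sequentially. rGamma_series z n * inverse (z * (1 / of_nat n) + 1) =
      exp ((1 - z) * of_real (ln (real n))) * (pochhammer z n / fact n)"
    \<comment> \<open>From n = 2 on, |z| <= 1 excludes z = -n, so dividing by z + n is
      legitimate.\<close>
    using eventually_ge_at_top[of 2]
  proof eventually_elim
    case (elim n)
    have n: "n > 0" using elim by simp
    have nz: "z + of_nat n \<noteq> 0"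
    proof
      assume "z + of_nat n = 0"
      hence "norm z = real n" by (metis add_eq_0_iff norm_minus_cancel norm_of_nat)
      thus False using z elim by simp
    qed
    have 1: "exp ((1 - z) * of_real (ln (real n))) = of_nat n / exp (z * of_real (ln (real n)))"
      using n by (simp add: left_diff_distrib exp_diff exp_of_real)
    have 2: "inverse (z * (1 / of_nat n) + 1) = of_nat n / (z + of_nat n)"
      using n by (simp add: field_simps)
    have 3: "rGamma_series z n = pochhammer z n * (z + of_nat n) / (fact n * exp (z * of_real (ln (real n))))"
      by (simp add: rGamma_series_def pochhammer_Suc)
    show ?case unfolding 1 2 3 using nz by (simp add: mult_ac)
  qed
  ultimately show ?thesis by (simp add: tendsto_cong)
qed

text \<open>For fixed k the normalised term tends to a_k/Gamma(z), as (d/(d-k))^(1-z) tends to 1.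
  Domination uses d/(d-k) <= k + 1 and Re (1 - z) <= 2, whence the weight in the hypothesis;
  Tannery's theorem exchanges limit and sum.\<close>

lemma tendsto_convolution_pochhammer:
  fixes a :: "nat \<Rightarrow> complex"
  assumes z: "norm z \<le> 1" and a: "summable (\<lambda>k. norm (a k) * real (k + 1) ^ 2)"
  shows "(\<lambda>d. exp ((1 - z) * of_real (ln (real d))) *
              (\<Sum>k\<le>d. a k * (pochhammer z (d - k) / fact (d - k)))) \<longlonglongrightarrow> rGamma z * (\<Sum>k. a k)"
proof -
  define e where "e n = exp ((1 - z) * of_real (ln (real n))) * (pochhammer z n / fact n)" for n
  have e: "e \<longlonglongrightarrow> rGamma z" unfolding e_def by (rule tendsto_pochhammer_over_fact[OF z])
  hence "Bseq e" by (rule convergent_imp_Bseq[OF convergentI])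
  then obtain B0 where B0: "\<And>n. norm (e n) \<le> B0" unfolding Bseq_def by blast
  \<comment> \<open>The bound is raised to at least 1 so that it also covers the boundary term k =
    d, which is estimated without \<open>e\<close>.\<close>
  define B where "B = max 1 B0"
  have B: "B \<ge> 1" "\<And>n. norm (e n) \<le> B" using B0 by (auto simp: B_def le_max_iff_disj)
  have Re_z: "Re (1 - z) \<le> 2" "Re (1 - z) \<ge> 0" using abs_Re_le_cmod[of z] z by auto
  define s where "s k d = (if k \<le> d then exp ((1 - z) * of_real (ln (real d))) * (a k * (pochhammer z (d - k) / fact (d - k))) else 0)" for k d
  have s_eq: "s k d = a k * (exp ((1 - z) * of_real (ln (real d) - ln (real (d - k)))) * e (d - k))"
    if "k < d" for k d
  proof -
    have "exp ((1 - z) * of_real (ln (real d))) =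
        exp ((1 - z) * of_real (ln (real d) - ln (real (d - k)))) * exp ((1 - z) * of_real (ln (real (d - k))))"
      by (simp add: algebra_simps flip: exp_add)
    thus ?thesis using that by (simp add: s_def e_def mult_ac)
  qed
  have lim: "(\<lambda>d. s k d) \<longlonglongrightarrow> a k * rGamma z" for k
  proof -
    have "(\<lambda>d. ln (real d) - ln (real d - real k)) \<longlonglongrightarrow> 0" by real_asymp
    hence "(\<lambda>d. ln (real d) - ln (real (d - k))) \<longlonglongrightarrow> 0"
      by (rule Lim_transform_eventually) (use eventually_ge_at_top[of k] in \<open>eventually_elim; simp add: of_nat_diff\<close>)
    hence "(\<lambda>d. a k * (exp ((1 - z) * of_real (ln (real d) - ln (real (d - k)))) * e (d - k)))
        \<longlonglongrightarrow> a k * (exp ((1 - z) * of_real 0) * rGamma z)"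
      by (intro tendsto_intros filterlim_compose[OF e] filterlim_minus_const_nat_at_top)
    moreover have "\<forall>\<^sub>F d in sequentially. a k * (exp ((1 - z) * of_real (ln (real d) - ln (real (d - k)))) * e (d - k)) = s k d"
      using eventually_gt_at_top[of k] by eventually_elim (simp add: s_eq)
    ultimately show ?thesis using Lim_transform_eventually by fastforce
  qed
  have bound: "norm (s k d) \<le> B * (norm (a k) * real (k + 1) ^ 2)" if d: "d \<ge> 1" for k d
  proof (cases k d rule: linorder_cases)
    case greater
    thus ?thesis using B by (simp add: s_def)
  next
    case equal
    have "norm (s k d) = norm (a k) * exp (Re (1 - z) * ln (real d))"
      using equal by (simp add: s_def norm_mult)
    also have "\<dots> \<le> norm (a k) * exp (2 * ln (real d))"
      using Re_z d by (intro mult_left_mono) (auto intro: mult_right_mono)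
    also have "exp (2 * ln (real d)) = real d ^ 2" using d by (simp add: exp_double)
    also have "norm (a k) * real d ^ 2 \<le> norm (a k) * real (k + 1) ^ 2"
      using equal by (intro mult_left_mono power_mono) auto
    also have "\<dots> \<le> B * (norm (a k) * real (k + 1) ^ 2)"
      using B by (intro mult_right_mono[of 1 B, simplified]) auto
    finally show ?thesis .
  next
    case less
    have pos: "real (d - k) > 0" using less by simp
    \<comment> \<open>With d = k + j + 1 this reads k + j + 1 <= (k + 1)(j + 1).\<close>
    have "d \<le> (k + 1) * (d - k)"
    proof -
      obtain j where "d = k + Suc j" using less less_iff_Suc_add by auto
      thus ?thesis by simp
    qed
    hence "real d \<le> real (k + 1) * real (d - k)" by (metis of_nat_le_iff of_nat_mult)
    hence "real d / real (d - k) \<le> real (k + 1)" using pos by (simp add: field_simps)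
    hence "ln (real d / real (d - k)) \<le> ln (real (k + 1))" using pos d by (intro ln_mono) auto
    hence ln_le: "ln (real d) - ln (real (d - k)) \<le> ln (real (k + 1))"
      using pos d by (simp add: ln_div)
    have "norm (exp ((1 - z) * of_real (ln (real d) - ln (real (d - k)))))
        = exp (Re (1 - z) * (ln (real d) - ln (real (d - k))))"
      by simp
    also have "\<dots> \<le> exp (2 * ln (real (k + 1)))"
    proof -
      have "Re (1 - z) * (ln (real d) - ln (real (d - k))) \<le> 2 * (ln (real d) - ln (real (d - k)))"
        using Re_z pos less by (intro mult_right_mono) auto
      thus ?thesis using ln_le by simp
    qed
    also have "\<dots> = real (k + 1) ^ 2" by (simp add: exp_double)
    finally have 1: "norm (exp ((1 - z) * of_real (ln (real d) - ln (real (d - k)))))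
        \<le> real (k + 1) ^ 2" .
    have "norm (s k d) = norm (a k) * (norm (exp ((1 - z) * of_real (ln (real d) - ln (real (d - k))))) * norm (e (d - k)))"
      by (simp only: s_eq[OF less] norm_mult)
    also have "\<dots> \<le> norm (a k) * (real (k + 1) ^ 2 * B)"
      using 1 B by (intro mult_left_mono mult_mono) auto
    finally show ?thesis by (simp add: mult_ac)
  qed
  have "\<forall>\<^sub>F (k, d) in at_top \<times>\<^sub>F sequentially. norm (s k d) \<le> B * (norm (a k) * real (k + 1) ^ 2)"
    unfolding eventually_prod_sequentially using bound by fastforce
  from tannerys_theorem[OF lim this summable_mult[OF a]]
  have "(\<lambda>d. \<Sum>k. s k d) \<longlonglongrightarrow> (\<Sum>k. a k * rGamma z)" by simp
  moreover have "(\<Sum>k. s k d) = exp ((1 - z) * of_real (ln (real d))) * (\<Sum>k\<le>d. a k * (pochhammer z (d - k) / fact (d - k)))" for d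
  proof -
    have "(\<Sum>k. s k d) = (\<Sum>k\<le>d. s k d)" by (rule suminf_finite) (auto simp: s_def)
    thus ?thesis by (simp add: s_def sum_distrib_left)
  qed
  moreover have "(\<Sum>k. a k * rGamma z) = rGamma z * (\<Sum>k. a k)"
  proof -
    have "summable (\<lambda>k. norm (a k))"
    proof (rule summable_comparison_test'[OF a, of 0])
      fix k :: nat
      have "norm (a k) * 1 \<le> norm (a k) * real (k + 1) ^ 2" by (intro mult_left_mono) auto
      thus "norm (norm (a k)) \<le> norm (a k) * real (k + 1) ^ 2" by simp
    qed
    hence "summable a" by (rule summable_norm_cancel)
    thus ?thesis using suminf_mult[of a "rGamma z"] by (simp add: mult.commute)
  qed
  ultimately show ?thesis by simp
qed


subsection \<open>Analytic continuation of the generating function\<close>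

text \<open>The Euler product at z = 1 says that \<open>Q D\<close> tends to 1 - qT. Its z-th power
  distributes over the primes because all factors are positive reals, whose real logarithms add, and
  it combines with the Euler product for z into local factors.\<close>

lemma euler_product_powr:
  fixes z :: complex and T :: real and q :: nat
  assumes q: "q = CARD('a::{field,finite})" and z: "norm z \<le> 1" and T: "0 < T" "real q * T < 1"
  shows "(\<lambda>D. \<Prod>p\<in>(monic_irreducibles \<inter> monics_upto D :: 'a poly set).
      local_factor z (of_real T ^ Polynomial.degree p))
     \<longlonglongrightarrow> of_real (1 - real q * T) powr z * infsum (euler_weight z T) (monics :: 'a poly set)"
proof -
  define P where "P D = (monic_irreducibles \<inter> monics_upto D :: 'a poly set)" for D
  have T': "0 \<le> T" "T < 1" using T T_less_1[OF q, of T] by auto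
  have t: "0 < 1 - T ^ Polynomial.degree p" if "p \<in> P D" for p D
    using that monic_irreduciblesD(5)[of p] T' by (simp add: P_def power_less_one_iff)
  define Q where "Q D = (\<Prod>p\<in>P D. 1 - T ^ Polynomial.degree p)" for D
  have Q: "Q D > 0" for D unfolding Q_def using t by (intro prod_pos) auto
  have "euler_weight 1 T = (\<lambda>f :: 'a poly. of_real (T ^ Polynomial.degree f))"
    by (auto simp: euler_weight_def)
  moreover have "((\<lambda>f :: 'a poly. of_real (T ^ Polynomial.degree f))
      has_sum complex_of_real (1 / (1 - real q * T))) monics"
    by (rule has_sum_of_real[OF has_sum_degree_power_monics[OF q T'(1) T(2)]])
  ultimately have inf: "infsum (euler_weight 1 T) (monics :: 'a poly set)
      = of_real (1 / (1 - real q * T))"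
    by (simp only: infsumI)
  have "(\<Prod>p\<in>P D. euler_factor 1 T p) = complex_of_real (inverse (Q D))" for D
  proof -
    have "(\<Prod>p\<in>P D. euler_factor 1 T p) =
        (\<Prod>p\<in>P D. of_real (inverse (1 - T ^ Polynomial.degree p)) :: complex)"
    proof (rule prod.cong)
      fix p assume "p \<in> P D"
      hence "complex_of_real (1 - T ^ Polynomial.degree p) \<noteq> 0"
        using t[of p D] by (subst of_real_eq_0_iff) auto
      thus "euler_factor 1 T p =
          (of_real (inverse (1 - T ^ Polynomial.degree p)) :: complex)"
        by (simp add: field_simps)
    qed simp
    also have "\<dots> = of_real (inverse (Q D))"
      unfolding of_real_prod[symmetric] Q_def prod_inversef[symmetric] by (simp only: o_def)
    finally show ?thesis .
  qed
  with euler_product_limit[OF q T'(1) T(2), of 1] inf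
  have "(\<lambda>D. complex_of_real (inverse (Q D))) \<longlonglongrightarrow> of_real (1 / (1 - real q * T))"
    by (simp add: P_def)
  hence "(\<lambda>D. inverse (complex_of_real (inverse (Q D)))) \<longlonglongrightarrow> inverse (of_real (1 / (1 - real q * T)))"
    by (rule tendsto_inverse) (use T in \<open>subst of_real_eq_0_iff, simp\<close>)
  hence "(\<lambda>D. complex_of_real (Q D)) \<longlonglongrightarrow> of_real (1 - real q * T)" by simp
  hence "(\<lambda>D. complex_of_real (Q D) powr z) \<longlonglongrightarrow> of_real (1 - real q * T) powr z"
    by (intro tendsto_powr_complex tendsto_const) (use T in \<open>auto simp: complex_nonpos_Reals_iff\<close>)
  from tendsto_mult[OF this euler_product_limit[OF q T'(1) T(2) z]]
  have lim: "(\<lambda>D. complex_of_real (Q D) powr z * (\<Prod>p\<in>P D. euler_factor z T p))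
    \<longlonglongrightarrow> of_real (1 - real q * T) powr z * infsum (euler_weight z T) (monics :: 'a poly set)"
    by (simp add: P_def)
  have "complex_of_real (Q D) powr z = (\<Prod>p\<in>P D. (1 - of_real T ^ Polynomial.degree p) powr z)" for D
  proof -
    have fin: "finite (P D)" unfolding P_def by (intro finite_Int disjI2 finite_monics_upto)
    have "complex_of_real (Q D) powr z = exp (z * of_real (ln (Q D)))"
      using Q[of D] by (simp add: powr_def Ln_of_real)
    also have "ln (Q D) = (\<Sum>p\<in>P D. ln (1 - T ^ Polynomial.degree p))"
      unfolding Q_def using fin t by (intro ln_prod) force+
    also have "exp (z * of_real (\<Sum>p\<in>P D. ln (1 - T ^ Polynomial.degree p)))
        = (\<Prod>p\<in>P D. exp (z * of_real (ln (1 - T ^ Polynomial.degree p))))"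
      using fin by (simp add: sum_distrib_left exp_sum)
    also have "\<dots> = (\<Prod>p\<in>P D. (1 - of_real T ^ Polynomial.degree p) powr z)"
    proof (rule prod.cong)
      fix p assume "p \<in> P D"
      from t[OF this] have "complex_of_real (1 - T ^ Polynomial.degree p) powr z
          = exp (z * of_real (ln (1 - T ^ Polynomial.degree p)))"
        by (simp add: powr_def Ln_of_real del: of_real_diff of_real_power)
      thus "exp (z * of_real (ln (1 - T ^ Polynomial.degree p)))
          = (1 - complex_of_real T ^ Polynomial.degree p) powr z"
        by simp
    qed simp
    finally show ?thesis .
  qed
  hence "complex_of_real (Q D) powr z * (\<Prod>p\<in>P D. euler_factor z T p) =
      (\<Prod>p\<in>P D. local_factor z (of_real T ^ Polynomial.degree p))" for D
    by (simp add: local_factor_def prod.distrib)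
  with lim show ?thesis by (simp add: P_def)
qed

lemma coeffs_prime_divs_fps:
  fixes z :: complex and q :: nat
  assumes q: "q = CARD('a::{field,finite})" and z: "norm z \<le> 1"
  defines "\<alpha> \<equiv> Abs_fps (\<lambda>d. \<Sum>f\<in>(monic_polys d :: 'a poly set). z ^ card (prime_divs f))"
  shows "fps_conv_radius \<alpha> \<ge> ereal (1 / real q)"
    and "0 < T \<Longrightarrow> real q * T < 1 \<Longrightarrow> eval_fps \<alpha> (of_real T)
        = infsum (euler_weight z T) (monics :: 'a poly set)"
proof -
  have q0: "real q > 0" using q card_field_ge_2[where 'a = 'a] by simp
  have sums: "(\<lambda>d. fps_nth \<alpha> d * of_real T ^ d) sums infsum (euler_weight z T) (monics :: 'a poly set)"
    if "0 < T" "real q * T < 1" for T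
    using euler_weight_sums[OF q _ that(2) z] that by (simp add: \<alpha>_def)
  show "fps_conv_radius \<alpha> \<ge> ereal (1 / real q)"
    unfolding fps_conv_radius_def
  proof (rule conv_radius_geI_ex')
    fix T :: real assume "0 < T" "ereal T < ereal (1 / real q)"
    thus "summable (\<lambda>d. fps_nth \<alpha> d * of_real T ^ d)"
      using sums[of T] q0 by (intro sums_summable[OF sums]) (auto simp: field_simps)
  qed
  show "0 < T \<Longrightarrow> real q * T < 1 \<Longrightarrow> eval_fps \<alpha> (of_real T)
      = infsum (euler_weight z T) (monics :: 'a poly set)"
    using sums by (simp add: eval_fps_def sums_iff)
qed

text \<open>The number \<open>L\<close> is the value at 1/q of the continued function
  \<open>h\<close>; it is obtained rather than defined so that both limits refer to the same
  value.\<close>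

lemma sum_prime_divs_asymptotics:
  fixes z :: complex and q :: nat
  assumes q: "q = CARD('a::{field,finite})" and z: "norm z \<le> 1"
  obtains L where
    "((\<lambda>S. \<Prod>p\<in>S. local_factor z (of_real (1 / real q) ^ Polynomial.degree p)) \<longlongrightarrow> L)
       (finite_subsets_at_top (monic_irreducibles :: 'a poly set))"
    "(\<lambda>d. exp ((1 - z) * of_real (ln (real d))) / of_nat q ^ d *
       (\<Sum>f\<in>(monic_polys d :: 'a poly set). z ^ card (prime_divs f))) \<longlonglongrightarrow> rGamma z * L"
proof -
  have q2: "real q \<ge> 2" using q card_field_ge_2[where 'a = 'a] by simp
  \<comment> \<open>The radius R is chosen between 1/q and q^(-1/2): the first bound puts the point
    1/q inside the disc, the second gives q R^2 < 1.\<close>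
  have "sqrt (real q) < sqrt (real q ^ 2)"
    using q2 by (subst real_sqrt_less_iff) (simp add: power2_eq_square)
  hence "sqrt (real q) < real q" by simp
  hence "1 / real q < 1 / sqrt (real q)" using q2 by (simp add: frac_less2)
  then obtain R where R: "1 / real q < R" "R < 1 / sqrt (real q)" using dense by blast
  have R0: "R > 0"
    using R(1) q2 by (meson divide_pos_pos less_trans zero_less_one less_le_trans zero_less_numeral)
  have "R ^ 2 < (1 / sqrt (real q)) ^ 2" using R R0 by (intro power_strict_mono) auto
  hence R2: "real q * R ^ 2 < 1" using q2 by (simp add: power_divide field_simps)
  have R1: "R < 1"
  proof -
    have "1 / sqrt (real q) \<le> 1" using q2 by simp
    thus ?thesis using R by simp
  qed
  obtain C where C: "C \<ge> 0" "\<And>t. norm t \<le> R \<Longrightarrow> norm (local_factor z t - 1) \<le> C * norm t ^ 2"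
    using local_factor_bound[OF R0 R1] by blast
  define I where "I = (monic_irreducibles :: 'a poly set)"
  have I: "I \<subseteq> monics" using monic_irreducibles_subset_monics by (simp add: I_def)
  have deg: "Polynomial.degree p > 0"
    if "p \<in> I" for p using that monic_irreduciblesD(5) by (simp add: I_def)
  have le_R: "norm (x ^ Polynomial.degree p) \<le> R" if "p \<in> I" "norm x \<le> R" for p and x :: complex
  proof -
    have "norm x ^ Polynomial.degree p \<le> R ^ Polynomial.degree p"
      using that by (intro power_mono) auto
    also have "\<dots> \<le> R ^ 1" using deg[OF that(1)] R0 R1 by (intro power_decreasing) auto
    finally show ?thesis by (simp add: norm_power)
  qed
  obtain h where h: "uniform_limit (cball 0 R) (\<lambda>S x. \<Prod>p\<in>S. local_factor z (x ^ Polynomial.degree p)) h (finite_subsets_at_top I)"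
  proof (rule uniform_limit_prod_finite_subsets)
    show "norm (local_factor z (x ^ Polynomial.degree p) - 1) \<le> C * (R ^ 2) ^ Polynomial.degree p"
      if "p \<in> I" "x \<in> cball 0 R" for p x
    proof -
      have "norm (local_factor z (x ^ Polynomial.degree p) - 1)
          \<le> C * norm (x ^ Polynomial.degree p) ^ 2"
        using le_R[of p x] that by (intro C) auto
      also have "norm (x ^ Polynomial.degree p) ^ 2 = (norm x ^ 2) ^ Polynomial.degree p"
        by (simp add: norm_power mult.commute flip: power_mult)
      also have "C * (norm x ^ 2) ^ Polynomial.degree p \<le> C * (R ^ 2) ^ Polynomial.degree p"
        using that C by (intro mult_left_mono power_mono) auto
      finally show ?thesis .
    qed
    \<comment> \<open>The sum over primes is dominated by the sum over all monic polynomials, with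
      R^2 in the role of T.\<close>
    have "(\<lambda>p. (R ^ 2) ^ Polynomial.degree p) summable_on (monics :: 'a poly set)"
      using has_sum_degree_power_monics[OF q _ R2] by (intro has_sum_imp_summable) auto
    thus "(\<lambda>p. C * (R ^ 2) ^ Polynomial.degree p) summable_on I"
      using I by (intro summable_on_cmult_right) (rule summable_on_subset_banach)
    show "filterlim (\<lambda>D. I \<inter> monics_upto D) (finite_subsets_at_top I) sequentially"
      by (rule filterlim_finite_subsets_bounded_degree[OF I])
  qed (use C in auto)
  have cont: "continuous_on (cball 0 R) (\<lambda>x. \<Prod>p\<in>S. local_factor z (x ^ Polynomial.degree p)) \<and>
      (\<lambda>x. \<Prod>p\<in>S. local_factor z (x ^ Polynomial.degree p)) holomorphic_on ball 0 R" if "S \<subseteq> I" for S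
  proof -
    have "local_factor z holomorphic_on ball 0 1"
      using local_factor_has_field_derivative has_field_derivative_at_within
      by (force simp: holomorphic_on_def field_differentiable_def)
    hence "local_factor z \<circ> (\<lambda>x. x ^ Polynomial.degree p) holomorphic_on ball 0 1" if "p \<in> S" for p
      by (rule holomorphic_on_compose_gen[rotated])
         (use deg[of p] that \<open>S \<subseteq> I\<close> in \<open>auto intro!: holomorphic_intros simp: norm_power power_less_one_iff\<close>)
    hence "(\<lambda>x. \<Prod>p\<in>S. local_factor z (x ^ Polynomial.degree p)) holomorphic_on ball 0 1"
      by (intro holomorphic_on_prod) (simp add: o_def)
    moreover have "cball 0 R \<subseteq> ball (0::complex) 1" "ball 0 R \<subseteq> ball (0::complex) 1"
      using R1 by auto
    ultimately show ?thesis
      by (meson continuous_on_subset holomorphic_on_imp_continuous_on holomorphic_on_subset)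
  qed
  have hol: "h holomorphic_on ball 0 R"
    by (rule holomorphic_uniform_limit[OF _ h]) (use cont in \<open>auto simp: eventually_finite_subsets_at_top\<close>)
  have lim: "((\<lambda>S. \<Prod>p\<in>S. local_factor z (x ^ Polynomial.degree p)) \<longlongrightarrow> h x) (finite_subsets_at_top I)"
    if "norm x \<le> R" for x
    using tendsto_uniform_limitI[OF h] that by simp
  define \<alpha> where "\<alpha> = Abs_fps (\<lambda>d. \<Sum>f\<in>(monic_polys d :: 'a poly set). z ^ card (prime_divs f))"
  have rad: "fps_conv_radius \<alpha> \<ge> ereal (1 / real q)"
    unfolding \<alpha>_def by (rule coeffs_prime_divs_fps(1)[OF q z])
  have h_real: "h (of_real T) = of_real (1 - real q * T) powr z * eval_fps \<alpha> (of_real T)"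
    if T: "0 < T" "real q * T < 1" for T
  proof -
    have "T < 1 / real q" using T q2 by (simp add: field_simps)
    hence "((\<lambda>S. \<Prod>p\<in>S. local_factor z (of_real T ^ Polynomial.degree p))
        \<longlongrightarrow> h (of_real T)) (finite_subsets_at_top I)"
      using T R by (intro lim) auto
    hence "(\<lambda>D. \<Prod>p\<in>I \<inter> monics_upto D. local_factor z (of_real T ^ Polynomial.degree p))
        \<longlonglongrightarrow> h (of_real T)"
      by (rule filterlim_compose) (rule filterlim_finite_subsets_bounded_degree[OF I])
    from LIMSEQ_unique[OF this] euler_product_powr[OF q z T] coeffs_prime_divs_fps(2)[OF q z T]
    show ?thesis by (simp add: I_def \<alpha>_def)
  qed
  have re: "0 < Re (1 - of_nat q * x)" if "x \<in> ball 0 (1 / real q)" for x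
  proof -
    have "norm (of_nat q * x) < 1" using that q2 by (simp add: norm_mult field_simps)
    thus ?thesis using complex_Re_le_cmod[of "of_nat q * x"] by simp
  qed
  \<comment> \<open>Identity theorem: both sides are holomorphic on the disc of radius 1/q, where 1
    - q x stays in the right half-plane, and they agree on the real interval (0, 1/q), which
    accumulates at 0.\<close>
  have h_eq: "h x = (1 - of_nat q * x) powr z * eval_fps \<alpha> x" if x: "x \<in> ball 0 (1 / real q)" for x
  proof -
    define g where "g = (\<lambda>x. h x - (1 - of_nat q * x) powr z * eval_fps \<alpha> x)"
    have "g x = 0"
    proof (rule analytic_continuation[where f = g and S = "ball 0 (1 / real q)"
          and U = "of_real ` {0<..<1 / real q}" and \<xi> = 0])
      have "h holomorphic_on ball 0 (1 / real q)"
        by (rule holomorphic_on_subset[OF hol]) (use R in auto)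
      moreover have "eval_fps \<alpha> holomorphic_on ball 0 (1 / real q)"
      proof (intro holomorphic_on_eval_fps subsetI)
        fix y :: complex assume "y \<in> ball 0 (1 / real q)"
        hence "ereal (norm y) < ereal (1 / real q)" by simp
        also note rad
        finally show "y \<in> eball 0 (fps_conv_radius \<alpha>)" by simp
      qed
      moreover have "(\<lambda>x. (1 - of_nat q * x) powr z) holomorphic_on ball 0 (1 / real q)"
        by (intro holomorphic_intros) (use re in \<open>force simp: complex_nonpos_Reals_iff\<close>)
      ultimately show "g holomorphic_on ball 0 (1 / real q)"
        unfolding g_def by (intro holomorphic_on_diff holomorphic_on_mult)
      show "of_real ` {0<..<1 / real q} \<subseteq> ball (0::complex) (1 / real q)" by auto
      show "0 \<in> ball (0::complex) (1 / real q)" using q2 by auto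
      show "(0::complex) islimpt of_real ` {0<..<1 / real q}"
      proof -
        have "\<exists>y\<in>of_real ` {0<..<1 / real q}. y \<noteq> 0 \<and> dist y (0::complex) < e" if "e > 0" for e
        proof -
          define y where "y = min e (1 / real q) / 2"
          have "0 < y" "y < 1 / real q" "y < e"
            using that q2 by (auto simp: y_def min_def field_simps)
          thus ?thesis by (intro bexI[of _ "of_real y"]) auto
        qed
        thus ?thesis unfolding islimpt_approachable by blast
      qed
      show "g y = 0" if y: "y \<in> of_real ` {0<..<1 / real q}" for y
      proof -
        obtain T where "y = of_real T" "0 < T" "T < 1 / real q" using y by auto
        thus ?thesis using h_real[of T] q2 by (simp add: g_def field_simps)
      qed
    qed (use x in auto)
    thus ?thesis by (simp add: g_def)
  qed
  have h_fps: "h has_fps_expansion fps_expansion h 0"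
    by (rule has_fps_expansion_fps_expansion[OF _ _ hol]) (use R0 in auto)
  define b where "b = fps_nth (fps_expansion h 0)"
  have "(\<lambda>x::complex. - of_nat q * x) has_fps_expansion fps_const (- of_nat q) * fps_X"
    by (intro fps_expansion_intros)
  hence "((\<lambda>x::complex. (1 + x) powr (- z)) \<circ> (\<lambda>x. - of_nat q * x)) has_fps_expansion
      fps_compose (fps_binomial (- z)) (fps_const (- of_nat q) * fps_X)"
    by (intro has_fps_expansion_compose has_fps_expansion_binomial_complex) auto
  from has_fps_expansion_mult[OF h_fps this]
  have "(\<lambda>x. h x * (1 - of_nat q * x) powr (- z)) has_fps_expansion
      fps_expansion h 0 * fps_compose (fps_binomial (- z)) (fps_const (- of_nat q) * fps_X)"
    by (simp add: o_def)
  moreover have "\<forall>\<^sub>F x in nhds 0. h x * (1 - of_nat q * x) powr (- z) = eval_fps \<alpha> x"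
  proof -
    have "\<forall>\<^sub>F x in nhds 0. x \<in> ball (0::complex) (1 / real q)"
      using q2 by (intro eventually_nhds_in_open) auto
    thus ?thesis
    proof eventually_elim
      case (elim x)
      have "1 - of_nat q * x \<noteq> 0" using re[OF elim] by (metis less_irrefl zero_complex.sel(1))
      thus ?case unfolding h_eq[OF elim] by (simp add: powr_minus field_simps)
    qed
  qed
  ultimately have "eval_fps \<alpha> has_fps_expansion
      fps_expansion h 0 * fps_compose (fps_binomial (- z)) (fps_const (- of_nat q) * fps_X)"
    by (rule has_fps_expansion_cong[THEN iffD1, rotated 2]) simp
  moreover have "eval_fps \<alpha> has_fps_expansion \<alpha>"
    using rad q2 by (intro eval_fps_has_fps_expansion) (auto intro: less_le_trans[rotated])
  ultimately have \<alpha>_eq: "\<alpha> = fps_expansion h 0 * fps_compose (fps_binomial (- z)) (fps_const (- of_nat q) * fps_X)"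
    using fps_expansion_unique_complex by blast
  have conv: "fps_nth \<alpha> d = (\<Sum>k\<le>d. b k * (of_nat q ^ (d - k) * (pochhammer z (d - k) / fact (d - k))))" for d
  proof -
    \<comment> \<open>The sign from the substitution x -> -q x cancels the sign in the binomial
      coefficient of -z.\<close>
    have "(- of_nat q) ^ n * ((- z) gchoose n) = of_nat q ^ n * (pochhammer z n / fact n)" for n
    proof -
      have "(- 1) ^ n * (- 1) ^ n = (1 :: complex)" by (simp flip: power_mult_distrib)
      moreover have "(- of_nat q) ^ n = (- 1) ^ n * (of_nat q ^ n :: complex)" by (rule power_minus)
      moreover have "((- z) gchoose n) = (- 1) ^ n * (pochhammer z n / fact n)"
        by (simp add: gbinomial_pochhammer)
      ultimately show ?thesis by (metis mult.assoc mult.left_commute mult_1)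
    qed
    thus ?thesis
      unfolding \<alpha>_eq fps_mult_nth fps_nth_compose_linear fps_binomial_nth b_def atLeast0AtMost
        by simp
  qed
  \<comment> \<open>Rescaling by q^k removes the powers of q from the convolution, and makes the sum
    of the coefficients the value of \<open>h\<close> at 1/q.\<close>
  define a where "a k = b k / of_nat q ^ k" for k
  have q0: "(of_nat q :: complex) \<noteq> 0" using q2 by auto
  have a_conv: "fps_nth \<alpha> d / of_nat q ^ d = (\<Sum>k\<le>d. a k * (pochhammer z (d - k) / fact (d - k)))"
    for d
    unfolding conv sum_divide_distrib
    by (intro sum.cong) (use q0 in \<open>auto simp: a_def field_simps simp flip: power_add\<close>)
  have "(\<lambda>k. b k * of_real (1 / real q) ^ k) sums h (of_real (1 / real q))"
    unfolding b_def
      by (rule has_fps_expansion_imp_sums_complex[OF h_fps, of R]) (use hol R q2 in \<open>auto simp: norm_divide\<close>)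
  hence "a sums h (of_real (1 / real q))" by (simp add: a_def[abs_def] power_divide field_simps)
  hence suminf_a: "(\<Sum>k. a k) = h (of_real (1 / real q))" by (simp add: sums_iff)
  \<comment> \<open>An intermediate radius leaves room for the weight: a_k = b_k s^k x^k with x =
    1/(q s) < 1, and (k + 1)^2 x^k is bounded.\<close>
  obtain s where s: "1 / real q < s" "s < R" using R(1) dense by blast
  have s0: "s > 0"
    using s(1) q2 by (meson divide_pos_pos less_trans zero_less_one less_le_trans zero_less_numeral)
  have "fps_conv_radius (fps_expansion h 0) \<ge> ereal R"
    by (rule conv_radius_fps_expansion) (use hol in simp)
  moreover have "ereal (norm (complex_of_real s)) < ereal R" using s s0 by simp
  ultimately have "ereal (norm (complex_of_real s)) < conv_radius b"
    unfolding b_def fps_conv_radius_def by (rule less_le_trans[rotated])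
  hence summ: "summable (\<lambda>k. norm (b k * of_real s ^ k))" by (rule abs_summable_in_conv_radius)
  define x where "x = 1 / (real q * s)"
  have x: "0 < x" "x < 1" using s s0 q2 by (auto simp: x_def field_simps)
  have "(\<lambda>k. real (k + 1) ^ 2 * x ^ k) \<longlonglongrightarrow> 0" using x by real_asymp
  hence "Bseq (\<lambda>k. real (k + 1) ^ 2 * x ^ k)" by (rule convergent_imp_Bseq[OF convergentI])
  then obtain K where K: "\<And>k. norm (real (k + 1) ^ 2 * x ^ k) \<le> K" unfolding Bseq_def by blast
  have "summable (\<lambda>k. norm (a k) * real (k + 1) ^ 2)"
  proof (rule summable_comparison_test'[OF summable_mult[OF summ, of K], of 0])
    fix k
    have "norm (a k) * real (k + 1) ^ 2 = norm (b k * of_real s ^ k) * (real (k + 1) ^ 2 * x ^ k)"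
      using s0 q2
        by (simp add: a_def x_def norm_mult norm_divide norm_power power_divide power_mult_distrib)
    also have "\<dots> \<le> norm (b k * of_real s ^ k) * K" using K[of k] by (intro mult_left_mono) auto
    finally
      show "norm (norm (a k) * real (k + 1) ^ 2) \<le> K * norm (b k * of_real s ^ k)"
        by (simp add: mult.commute)
  qed
  from tendsto_convolution_pochhammer[OF z this]
  have "(\<lambda>d. exp ((1 - z) * of_real (ln (real d))) / of_nat q ^ d * fps_nth \<alpha> d)
      \<longlonglongrightarrow> rGamma z * h (of_real (1 / real q))"
    unfolding suminf_a a_conv[symmetric] by simp
  moreover have "((\<lambda>S. \<Prod>p\<in>S. local_factor z (of_real (1 / real q) ^ Polynomial.degree p))
      \<longlongrightarrow> h (of_real (1 / real q)))
      (finite_subsets_at_top I)"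
    using R q2 by (intro lim) (auto simp: norm_divide)
  ultimately show ?thesis using that[of "h (of_real (1 / real q))"] by (simp add: I_def \<alpha>_def)
qed

section \<open>Identification of the limit with \<open>Phi1\<close> and \<open>Phi2\<close>\<close>

theorem theorem6p4:
  fixes u :: real and q :: nat
  assumes "q = CARD('a::{field,finite})"
  shows "(\<lambda>d::nat. exp ((1 - exp (\<i> * of_real u)) * of_real (ln (real d))) / of_nat q ^ d *
              (\<Sum>f\<in>(monic_polys d :: 'a poly set). exp (\<i> * of_real u * of_nat (r f))))
         \<longlonglongrightarrow> exp (\<i> * of_real u) * Phi1 u * Phi2 TYPE('a) u"
proof -
  define z where "z = exp (\<i> * of_real u)"
  have z: "norm z \<le> 1" by (simp add: z_def)
  obtain L where L:
    "((\<lambda>S. \<Prod>p\<in>S. local_factor z (of_real (1 / real q) ^ Polynomial.degree p)) \<longlongrightarrow> L)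
       (finite_subsets_at_top (monic_irreducibles :: 'a poly set))"
    "(\<lambda>d. exp ((1 - z) * of_real (ln (real d))) / of_nat q ^ d *
       (\<Sum>f\<in>(monic_polys d :: 'a poly set). z ^ card (prime_divs f))) \<longlonglongrightarrow> rGamma z * L"
    using sum_prime_divs_asymptotics[OF assms z] .
  have q2: "real q \<ge> 2" using assms card_field_ge_2[where 'a = 'a] by simp
  have "local_factor z (of_real (1 / real q) ^ Polynomial.degree p) =
      of_real (1 - 1 / poly_norm p) powr z * (1 + z / of_real (poly_norm p - 1))"
    if "p \<in> monic_irreducibles" for p :: "'a poly"
  proof -
    have "1 < real q ^ Polynomial.degree p"
      using monic_irreduciblesD(5)[OF that] q2 by (intro one_less_power) auto
    hence n: "1 < poly_norm p" by (simp add: poly_norm_def assms)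
    have t: "of_real (1 / real q) ^ Polynomial.degree p = complex_of_real (1 / poly_norm p)"
      by (simp add: poly_norm_def assms power_divide)
    have "complex_of_real (1 / poly_norm p) / (1 - complex_of_real (1 / poly_norm p)) =
        of_real ((1 / poly_norm p) / (1 - 1 / poly_norm p))" by simp
    also have "(1 / poly_norm p) / (1 - 1 / poly_norm p) = 1 / (poly_norm p - 1)"
      using n by (simp add: field_simps)
    finally have "z * complex_of_real (1 / poly_norm p) / (1 - complex_of_real (1 / poly_norm p))
        = z / of_real (poly_norm p - 1)"
      by (simp add: field_simps)
    thus ?thesis unfolding local_factor_def t by simp
  qed
  hence eq: "(\<Prod>p\<in>S. local_factor z (of_real (1 / real q) ^ Polynomial.degree p)) =
      (\<Prod>p\<in>S. of_real (1 - 1 / poly_norm p) powr z * (1 + z / of_real (poly_norm p - 1)))"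
    if "S \<subseteq> monic_irreducibles" for S :: "'a poly set"
    using that by (intro prod.cong) auto
  have "\<forall>\<^sub>F S in finite_subsets_at_top (monic_irreducibles :: 'a poly set).
      (\<Prod>p\<in>S. local_factor z (of_real (1 / real q) ^ Polynomial.degree p)) =
      (\<Prod>p\<in>S. of_real (1 - 1 / poly_norm p) powr z * (1 + z / of_real (poly_norm p - 1)))"
    unfolding eventually_finite_subsets_at_top using eq by blast
  from tendsto_cong[OF this] L(1)
  have "((\<lambda>S. \<Prod>p\<in>S. of_real (1 - 1 / poly_norm p) powr z * (1 + z / of_real (poly_norm p - 1))) \<longlongrightarrow> L)
      (finite_subsets_at_top (monic_irreducibles :: 'a poly set))"
    by (rule iffD1)
  \<comment> \<open>Convergence has been established, so \<open>Lim\<close> returns the actual limit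
    of the partial products.\<close>
  hence Phi2: "Phi2 TYPE('a) u = L"
    unfolding Phi2_def z_def by (intro tendsto_Lim) auto
  \<comment> \<open>The functional equation of the entire function 1/Gamma; it holds at z = -1 as
    well, where both sides are 0 thanks to the conventions at the pole.\<close>
  have Phi1: "z * Phi1 u = rGamma z"
    using rGamma_plus1[of z] by (simp add: Phi1_def rGamma_inverse_Gamma divide_inverse flip: z_def)
  have "exp (\<i> * of_real u * of_nat (r f)) = z ^ card (prime_divs f)"
    if "f \<in> monic_polys d" for f :: "'a poly" and d
  proof -
    have "f \<noteq> 0" using that by (auto simp: monic_polys_def)
    thus ?thesis by (simp add: z_def r_eq_card_prime_divs mult.commute flip: exp_of_nat_mult)
  qed
  hence "(\<Sum>f\<in>(monic_polys d :: 'a poly set). exp (\<i> * of_real u * of_nat (r f))) =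
      (\<Sum>f\<in>(monic_polys d :: 'a poly set). z ^ card (prime_divs f))" for d
    by (intro sum.cong) auto
  thus ?thesis using L(2) Phi1 Phi2 by (simp flip: z_def)
qed

end
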